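(* Let $K\ge 2$ and consider the symmetric $K$-user fully connected Gaussian interference channel with output feedback, with $\mathsf{INR}=\mathsf{SNR}^{\alpha}$, $\alpha\ge 0$. Its per-user number of generalized degrees of freedom $d_{\mathrm{FB}}(\alpha)$ is given, for $\alpha\neq 1$, by $$d_{\mathrm{FB}}(\alpha)=\begin{cases}1-\dfrac{\alpha}{2}, & \alpha<1,\\[2mm] \dfrac{\alpha}{2}, & \alpha>1.\end{cases}$$
   Context: Channel model: there are $K$ transmitters and $K$ receivers; transmitter $k$ has a message $W_k$ for receiver $k$, the messages being independent and uniformly distributed. At time $t$ receiver $k$ observes the real signal $$y_k(t)=\sqrt{\mathsf{SNR}}\,x_k(t)+\sum_{i\neq k}\sqrt{\mathsf{INR}}\,x_i(t)+z_k(t),$$ where $x_i(t)\in\mathbb{R}$ is the input of transmitter $i$, the noises $z_k(t)\sim\mathcal N(0,1)$ are independent over $k$ and $t$ and independent of the messages, and $\mathsf{SNR},\mathsf{INR}>0$ are constants. Inputs have power constraint $\mathbb E[x_k^2]\le 1$ (average power over the block: $\frac1T\sum_{t=1}^T\mathbb E[x_k(t)^2]\le 1$ for block length $T$). Output feedback: each transmitter has causal noiseless feedback from its own receiver, i.e. $x_k(t)=g_{kt}(W_k,y_k(1),\dots,y_k(t-1))$. Receiver $k$ decodes $W_k$ from $y_k(1),\dots,y_k(T)$. A rate tuple $(R_1,\dots,R_K)$ (bits per channel use; $\log$ is base 2) is achievable if there is a family of such codes with block length $T$, with message set of user $k$ of size at least $2^{TR_k}$, whose average decoding error probability tends to $0$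 for all users as $T\to\infty$. Let $R_{\mathrm{sym}}(\mathsf{SNR},\mathsf{INR})$ be the supremum of $R$ such that $(R,\dots,R)$ is achievable. The per-user generalized degrees of freedom are $$d_{\mathrm{FB}}(\alpha)=\limsup_{\mathsf{SNR}\to\infty}\frac{R_{\mathrm{sym}}(\mathsf{SNR},\mathsf{SNR}^{\alpha})}{\frac12\log\mathsf{SNR}}.$$ *)

theory Defs
  imports "HOL-Probability.Probability"
begin

text \<open>
  Users are indexed by \<open>{..<K}\<close> and channel uses by \<open>{..<T}\<close>.  The encoder \<open>enc C k t m h\<close>
  of user \<open>k\<close> at time \<open>t\<close> receives its message \<open>m\<close> and the record \<open>h\<close> of its receiver's
  outputs at the times \<open>s < t\<close>; \<open>h\<close> is a point of the product space over \<open>{..<t}\<close>, hence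
  \<open>undefined\<close> at all other times, so that the encoders are causal by construction.
\<close>

record code =
  msgs :: "nat \<Rightarrow> nat"
  enc :: "nat \<Rightarrow> nat \<Rightarrow> nat \<Rightarrow> (nat \<Rightarrow> real) \<Rightarrow> real"
  dec :: "nat \<Rightarrow> (nat \<Rightarrow> real) \<Rightarrow> nat"

definition channel_output ::
  "nat \<Rightarrow> real \<Rightarrow> real \<Rightarrow> (nat \<Rightarrow> real) \<Rightarrow> (nat \<Rightarrow> real) \<Rightarrow> nat \<Rightarrow> real" where
  "channel_output K snr inr x z k =
     sqrt snr * x k + (\<Sum>i\<in>{..<K} - {k}. sqrt inr * x i) + z k"

text \<open>
  \<open>outputs K snr inr C w z t k\<close> is the record of the outputs of receiver \<open>k\<close> at the times
  \<open>s < t\<close>, where \<open>w i\<close> is the message of user \<open>i\<close> and \<open>z (i, s)\<close> the noise at receiver \<open>i\<close> at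
  time \<open>s\<close>.
\<close>

primrec outputs ::
  "nat \<Rightarrow> real \<Rightarrow> real \<Rightarrow> code \<Rightarrow> (nat \<Rightarrow> nat) \<Rightarrow> (nat \<times> nat \<Rightarrow> real) \<Rightarrow>
     nat \<Rightarrow> nat \<Rightarrow> nat \<Rightarrow> real" where
  "outputs K snr inr C w z 0 = (\<lambda>k s. undefined)"
| "outputs K snr inr C w z (Suc t) =
     (\<lambda>k. (outputs K snr inr C w z t k)
        (t := channel_output K snr inr
           (\<lambda>i. enc C i t (w i) (outputs K snr inr C w z t i)) (\<lambda>i. z (i, t)) k))"

definition input ::
  "nat \<Rightarrow> real \<Rightarrow> real \<Rightarrow> code \<Rightarrow> (nat \<Rightarrow> nat) \<Rightarrow> (nat \<times> nat \<Rightarrow> real) \<Rightarrow>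
     nat \<Rightarrow> nat \<Rightarrow> real" where
  "input K snr inr C w z k t = enc C k t (w k) (outputs K snr inr C w z t k)"

text \<open>
  The joint law of messages and noises: the message of user \<open>k\<close> is uniform on
  \<open>{..<msgs C k}\<close>, the noises are standard normal, and all of them are independent.
\<close>

definition msg_noise :: "nat \<Rightarrow> nat \<Rightarrow> code \<Rightarrow> ((nat \<Rightarrow> nat) \<times> (nat \<times> nat \<Rightarrow> real)) measure" where
  "msg_noise K T C =
     (\<Pi>\<^sub>M k\<in>{..<K}. measure_pmf (pmf_of_set {..<msgs C k})) \<Otimes>\<^sub>M
     (\<Pi>\<^sub>M kt\<in>{..<K} \<times> {..<T}. density lborel std_normal_density)"

text \<open>
  Integrability of the squared inputs is required explicitly because the Bochner integral of
  a non-integrable function is \<open>0\<close>.  Measurability is required of \<open>enc C k t m\<close> for all \<open>m\<close>, also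
  those \<open>m \<ge> msgs C k\<close> that occur with probability \<open>0\<close>: they belong to the sample space, and
  without it the error event could be non-measurable, and then have \<open>measure\<close> \<open>0\<close>, in \<open>error_prob\<close>.
\<close>

definition feedback_code :: "nat \<Rightarrow> real \<Rightarrow> real \<Rightarrow> nat \<Rightarrow> code \<Rightarrow> bool" where
  "feedback_code K snr inr T C \<longleftrightarrow>
     (\<forall>k<K.
        0 < msgs C k \<and>
        (\<forall>t<T. \<forall>m. enc C k t m \<in> borel_measurable (\<Pi>\<^sub>M s\<in>{..<t}. borel)) \<and>
        dec C k \<in> (\<Pi>\<^sub>M s\<in>{..<T}. borel) \<rightarrow>\<^sub>M count_space UNIV \<and>
        (\<forall>t<T. integrable (msg_noise K T C) (\<lambda>(w, z). (input K snr inr C w z k t)\<^sup>2)) \<and>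
        1 / real T *
          (\<Sum>t<T. \<integral>(w, z). (input K snr inr C w z k t)\<^sup>2 \<partial>msg_noise K T C) \<le> 1)"

definition error_prob :: "nat \<Rightarrow> real \<Rightarrow> real \<Rightarrow> nat \<Rightarrow> code \<Rightarrow> nat \<Rightarrow> real" where
  "error_prob K snr inr T C k =
     measure (msg_noise K T C)
       {(w, z) \<in> space (msg_noise K T C). dec C k (outputs K snr inr C w z T k) \<noteq> w k}"

definition achievable :: "nat \<Rightarrow> real \<Rightarrow> real \<Rightarrow> (nat \<Rightarrow> real) \<Rightarrow> bool" where
  "achievable K snr inr R \<longleftrightarrow>
     (\<exists>C. (\<forall>T. feedback_code K snr inr T (C T) \<and>
               (\<forall>k<K. 2 powr (real T * R k) \<le> real (msgs (C T) k))) \<and>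
          (\<forall>k<K. (\<lambda>T. error_prob K snr inr T (C T) k) \<longlonglongrightarrow> 0))"

definition R_sym :: "nat \<Rightarrow> real \<Rightarrow> real \<Rightarrow> ereal" where
  "R_sym K snr inr = (SUP R\<in>{R. achievable K snr inr (\<lambda>k. R)}. ereal R)"

definition d_FB :: "nat \<Rightarrow> real \<Rightarrow> ereal" where
  "d_FB K \<alpha> = Limsup at_top (\<lambda>snr. R_sym K snr (snr powr \<alpha>) / ereal (1 / 2 * log 2 snr))"

end

theory Submission
  imports Defs "HOL-Real_Asymp.Real_Asymp"
begin

text \<open>
  Converse. Compare the density of all the outputs \<open>y\<close>, given the messages, with the product of an
  i.i.d. Gaussian density for \<open>y\<^sub>0\<close>, of variance \<open>1 + SNR + INR\<close>, and of a causal Gaussian kernel that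
  predicts the other outputs from \<open>y\<^sub>0\<close> and all messages but \<open>w\<^sub>1\<close>: knowing the inputs other than \<open>x\<^sub>1\<close>,
  one reads \<open>\<surd>INR x\<^sub>1 + z\<^sub>0\<close> off \<open>y\<^sub>0\<close>, so that \<open>y\<^sub>1\<close> is predicted with error variance
  \<open>1 + SNR / INR\<close> and each further output with bounded error variance. Under the comparison density, at most
  one value of \<open>w\<^sub>1\<close> is decoded from \<open>y\<close> and then at most one value of \<open>w\<^sub>0\<close> from \<open>y\<^sub>0\<close>, so that
  correct decoding contributes at most \<open>1 / (M\<^sub>0 M\<^sub>1)\<close>. As the expected log-likelihood ratio is at most
  \<open>T/2 (ln (1 + SNR + INR) + ln (1 + SNR / INR) + O(1))\<close>, this bounds \<open>2 R\<close>.

  Achievability. In the first of two channel uses the users send integers. Feedback tells each user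
  the sum of the other users' integers, hence the sum of all of them, which all users then send
  together. From this sum \<open>S\<close> and the first output each receiver solves for its own integer, whose
  net gain is \<open>\<surd>SNR - \<surd>INR\<close>; this is where \<open>\<alpha> \<noteq> 1\<close> is used. If \<open>\<alpha> < 1\<close>, fresh digits below
  the noise level of the unintended receivers are superposed in both channel uses. A digit can only be
  wrong where some noise is large, which happens in a small fraction of the channel uses, and an
  outer Gilbert-Varshamov code of small relative distance corrects these errors.
\<close>

section \<open>Triangular shifts preserve Lebesgue measure\<close>

lemma nn_integral_lborel_translate:
  fixes c :: real
  assumes [measurable]: "f \<in> borel_measurable borel"
  shows "(\<integral>\<^sup>+t. f (t + c) \<partial>lborel) = (\<integral>\<^sup>+t. f t \<partial>lborel)"
  using nn_integral_real_affine[of f 1 c] by (simp add: add.commute)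

lemma measurable_PiM_lborel:
  "measurable (\<Pi>\<^sub>M i\<in>I. lborel) N = measurable (\<Pi>\<^sub>M i\<in>I. borel) N"
  by (intro measurable_cong_sets sets_PiM_cong) auto

text \<open>Translation invariance, one coordinate at a time: a coordinate of maximal rank is
  integrated first, its shift being constant along it, and the other shifts do not see it. This
  replaces a Jacobian, which merely measurable encoders do not have.\<close>

lemma nn_integral_PiM_triangular_shift:
  fixes r :: "'i \<Rightarrow> nat" and s :: "'i \<Rightarrow> ('i \<Rightarrow> real) \<Rightarrow> real"
  assumes "finite I"
    and "\<And>i. i \<in> I \<Longrightarrow> s i \<in> borel_measurable (\<Pi>\<^sub>M i\<in>I. borel)"
    and "\<And>i y y'. i \<in> I \<Longrightarrow> (\<And>j. j \<in> I \<Longrightarrow> r j < r i \<Longrightarrow> y j = y' j) \<Longrightarrow> s i y = s i y'"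
    and "f \<in> borel_measurable (\<Pi>\<^sub>M i\<in>I. borel)"
  shows "(\<integral>\<^sup>+y. f (\<lambda>i\<in>I. y i + s i y) \<partial>(\<Pi>\<^sub>M i\<in>I. lborel)) = (\<integral>\<^sup>+y. f y \<partial>(\<Pi>\<^sub>M i\<in>I. lborel))"
  using assms
proof (induction I arbitrary: f s rule: finite_ranking_induct[where f = r])
  case empty
  have "(\<lambda>i\<in>{}. y i + s i y) = y" if "y \<in> space (\<Pi>\<^sub>M i\<in>{}. lborel)" for y
    using that by (auto simp: space_PiM)
  then show ?case by (intro nn_integral_cong) simp
next
  case (insert x S)
  interpret product_sigma_finite "\<lambda>_::'i. lborel :: real measure" ..
  show ?case
  \<comment> \<open>The ranking induction does not exclude that \<open>x\<close> lies in
    \<open>S\<close> already.\<close>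
  proof (cases "x \<in> S")
    case True
    then have eq: "insert x S = S" by auto
    show ?thesis unfolding eq
      by (rule insert.IH) (use insert.prems[unfolded eq] in blast)+
  next
    case False
    have ms: "s i \<in> borel_measurable (\<Pi>\<^sub>M i\<in>insert x S. borel)" if "i \<in> insert x S" for i
      using insert.prems(1) that by blast
    \<comment> \<open>No shift, not even that of \<open>x\<close> itself, reads a coordinate of
      maximal rank.\<close>
    have dep: "s i (y(x := t)) = s i y" if "i \<in> insert x S" for i y t
      using that by (intro insert.prems(2)) (auto dest: insert.hyps(2))
    have upd: "(\<lambda>y. y(x := t)) \<in> (\<Pi>\<^sub>M i\<in>S. borel) \<rightarrow>\<^sub>M (\<Pi>\<^sub>M i\<in>insert x S. borel)" for t :: real
      by (rule measurable_fun_upd[where J = S]) auto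
    have mS: "s i \<in> borel_measurable (\<Pi>\<^sub>M i\<in>S. borel)" if "i \<in> insert x S" for i
      using measurable_compose[OF upd ms[OF that], of 0] dep[OF that] by simp
    have mm: "(\<lambda>y. \<lambda>i\<in>S. y i + s i y) \<in> (\<Pi>\<^sub>M i\<in>S. borel) \<rightarrow>\<^sub>M (\<Pi>\<^sub>M i\<in>S. borel)"
      using mS by (intro measurable_restrict borel_measurable_add) auto
    have mm': "(\<lambda>y. \<lambda>i\<in>insert x S. y i + s i y) \<in> (\<Pi>\<^sub>M i\<in>insert x S. borel) \<rightarrow>\<^sub>M (\<Pi>\<^sub>M i\<in>insert x S. borel)"
      using ms by (intro measurable_restrict borel_measurable_add) auto
    have "(\<integral>\<^sup>+y. f (\<lambda>i\<in>insert x S. y i + s i y) \<partial>(\<Pi>\<^sub>M i\<in>insert x S. lborel))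
      = (\<integral>\<^sup>+y. \<integral>\<^sup>+t. f (\<lambda>i\<in>insert x S. (y(x := t)) i + s i (y(x := t))) \<partial>lborel \<partial>(\<Pi>\<^sub>M i\<in>S. lborel))"
      by (subst product_nn_integral_insert[OF insert.hyps(1) False])
        (unfold measurable_PiM_lborel, rule measurable_compose[OF mm' insert.prems(3)], simp)
    also have "\<dots> = (\<integral>\<^sup>+y. \<integral>\<^sup>+t. f ((\<lambda>i\<in>S. y i + s i y)(x := t + s x y)) \<partial>lborel \<partial>(\<Pi>\<^sub>M i\<in>S. lborel))"
    proof (intro nn_integral_cong arg_cong[where f = f] ext)
      fix y t i
      show "(\<lambda>i\<in>insert x S. (y(x := t)) i + s i (y(x := t))) i = ((\<lambda>i\<in>S. y i + s i y)(x := t + s x y)) i"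
        using False dep[of i y t] by (cases "i = x") auto
    qed
    also have "\<dots> = (\<integral>\<^sup>+y. \<integral>\<^sup>+t. f ((\<lambda>i\<in>S. y i + s i y)(x := t)) \<partial>lborel \<partial>(\<Pi>\<^sub>M i\<in>S. lborel))"
    proof (rule nn_integral_cong)
      fix y
      have "(\<lambda>t. (\<lambda>i\<in>S. y i + s i y)(x := t)) \<in> borel \<rightarrow>\<^sub>M (\<Pi>\<^sub>M i\<in>insert x S. borel)"
        by (rule measurable_fun_upd[where J = S]) (auto simp: space_PiM)
      then have "(\<lambda>t. f ((\<lambda>i\<in>S. y i + s i y)(x := t))) \<in> borel_measurable borel"
        by (rule measurable_compose[OF _ insert.prems(3)])
      from nn_integral_lborel_translate[OF this, of "s x y"]
      show "(\<integral>\<^sup>+t. f ((\<lambda>i\<in>S. y i + s i y)(x := t + s x y)) \<partial>lborel) =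
        (\<integral>\<^sup>+t. f ((\<lambda>i\<in>S. y i + s i y)(x := t)) \<partial>lborel)" .
    qed
    also have "\<dots> = (\<integral>\<^sup>+y. \<integral>\<^sup>+t. f (y(x := t)) \<partial>lborel \<partial>(\<Pi>\<^sub>M i\<in>S. lborel))"
    proof (rule insert.IH[where f = "\<lambda>y. \<integral>\<^sup>+t. f (y(x := t)) \<partial>lborel"])
      show "s i y = s i y'" if "i \<in> S" "\<And>j. j \<in> S \<Longrightarrow> r j < r i \<Longrightarrow> y j = y' j" for i y y'
        using that insert.hyps(2)[of i] by (intro insert.prems(2)) auto
    
      have "(\<lambda>p. (fst p)(x := snd p)) \<in> (\<Pi>\<^sub>M i\<in>S. borel) \<Otimes>\<^sub>M lborel \<rightarrow>\<^sub>M (\<Pi>\<^sub>M i\<in>insert x S. (borel :: real measure))"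
        by (rule measurable_fun_upd[where J = S]) auto
      from measurable_compose[OF this insert.prems(3)]
      show "(\<lambda>y. \<integral>\<^sup>+t. f (y(x := t)) \<partial>lborel) \<in> borel_measurable (\<Pi>\<^sub>M i\<in>S. borel)"
        by (intro lborel.borel_measurable_nn_integral) (simp add: case_prod_beta' del: fun_upd_apply)
    qed (use mS in auto)
    also have "\<dots> = (\<integral>\<^sup>+y. f y \<partial>(\<Pi>\<^sub>M i\<in>insert x S. lborel))"
      by (rule product_nn_integral_insert[OF insert.hyps(1) False, symmetric])
        (unfold measurable_PiM_lborel, rule insert.prems(3))
    finally show ?thesis .
  qed
qed

section \<open>Laws of the noises and of the messages\<close>

text \<open>Turns expectations over the noises into Lebesgue integrals, to which triangular shifts
  apply.\<close>

lemma PiM_density_lborel: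
  fixes f :: "real \<Rightarrow> real"
  assumes "finite I" and [measurable]: "f \<in> borel_measurable borel" and "\<And>x. 0 \<le> f x"
    and "prob_space (density lborel f)"
  shows "(\<Pi>\<^sub>M i\<in>I. density lborel f) = density (\<Pi>\<^sub>M i\<in>I. lborel) (\<lambda>z. \<Prod>i\<in>I. f (z i))"
proof -
  interpret f: prob_space "density lborel f" by fact
  interpret f: product_sigma_finite "\<lambda>_. density lborel f" ..
  interpret L: product_sigma_finite "\<lambda>_. lborel :: real measure" ..
  show ?thesis
  proof (rule f.PiM_eqI[OF assms(1), symmetric])
    show "sets (density (\<Pi>\<^sub>M i\<in>I. lborel) (\<lambda>z. \<Prod>i\<in>I. f (z i))) = sets (\<Pi>\<^sub>M i\<in>I. density lborel f)"
      by (auto intro!: sets_PiM_cong)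
    fix A assume "\<And>i. i \<in> I \<Longrightarrow> A i \<in> sets (density lborel f)"
    then have A: "A i \<in> sets borel" if "i \<in> I" for i
      using that by simp
    have 1: "Pi\<^sub>E I A \<in> sets (\<Pi>\<^sub>M i\<in>I. lborel)"
      using assms(1) A by (intro sets_PiM_I_finite) auto
    have "emeasure (density (\<Pi>\<^sub>M i\<in>I. lborel) (\<lambda>z. \<Prod>i\<in>I. f (z i))) (Pi\<^sub>E I A)
      = (\<integral>\<^sup>+z. ennreal (\<Prod>i\<in>I. f (z i)) * indicator (Pi\<^sub>E I A) z \<partial>(\<Pi>\<^sub>M i\<in>I. lborel))"
      using 1 by (intro emeasure_density) auto
    also have "\<dots> = (\<integral>\<^sup>+z. (\<Prod>i\<in>I. ennreal (f (z i)) * indicator (A i) (z i)) \<partial>(\<Pi>\<^sub>M i\<in>I. lborel))"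
    proof (rule nn_integral_cong)
      fix z assume "z \<in> space (\<Pi>\<^sub>M i\<in>I. lborel :: real measure)"
      then have "indicator (Pi\<^sub>E I A) z = (\<Prod>i\<in>I. indicator (A i) (z i) :: ennreal)"
        using assms(1) by (auto simp: indicator_def space_PiM PiE_def Pi_def prod_zero_iff)
      then show "ennreal (\<Prod>i\<in>I. f (z i)) * indicator (Pi\<^sub>E I A) z
          = (\<Prod>i\<in>I. ennreal (f (z i)) * indicator (A i) (z i))"
        by (simp add: prod.distrib prod_ennreal assms(3))
    qed
    also have "\<dots> = (\<Prod>i\<in>I. \<integral>\<^sup>+x. ennreal (f x) * indicator (A i) x \<partial>lborel)"
      using A by (intro L.product_nn_integral_prod[OF assms(1)]) auto
    also have "\<dots> = (\<Prod>i\<in>I. emeasure (density lborel f) (A i))"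
      using A by (intro prod.cong refl emeasure_density[symmetric]) auto
    finally show "emeasure (density (\<Pi>\<^sub>M i\<in>I. lborel) (\<lambda>z. \<Prod>i\<in>I. f (z i))) (Pi\<^sub>E I A)
      = (\<Prod>i\<in>I. emeasure (density lborel f) (A i))" .
  qed
qed

abbreviation msg_law :: "nat \<Rightarrow> (nat \<Rightarrow> nat) \<Rightarrow> (nat \<Rightarrow> nat) measure" where
  "msg_law K M \<equiv> (\<Pi>\<^sub>M k\<in>{..<K}. measure_pmf (pmf_of_set {..<M k}))"

abbreviation noise_law :: "nat \<Rightarrow> nat \<Rightarrow> (nat \<times> nat \<Rightarrow> real) measure" where
  "noise_law K T \<equiv> (\<Pi>\<^sub>M kt\<in>{..<K} \<times> {..<T}. density lborel std_normal_density)"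

lemma sets_msg_law: "sets (msg_law K M) = Pow (PiE {..<K} (\<lambda>_. UNIV))"
proof -
  have "sets (msg_law K M) = sets (\<Pi>\<^sub>M k\<in>{..<K}. count_space (UNIV :: nat set))"
    by (intro sets_PiM_cong) auto
  also have "\<dots> = Pow (PiE {..<K} (\<lambda>_. UNIV))"
    by (subst count_space_PiM_finite) auto
  finally show ?thesis .
qed

lemma space_msg_law: "space (msg_law K M) = PiE {..<K} (\<lambda>_. UNIV)"
  by (simp add: space_PiM)

lemma measurable_msg_law: "f \<in> borel_measurable (msg_law K M)"
  by (auto simp: measurable_def sets_msg_law space_msg_law)

text \<open>There are only countably many message tuples, so joint measurability can be checked for
  each fixed tuple.\<close>

lemma measurable_msg_law_pair:
  assumes "\<And>w. f w \<in> measurable N L"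
  shows "(\<lambda>(w, z). f w z) \<in> measurable (msg_law K M \<Otimes>\<^sub>M N) L"
proof -
  let ?S = "PiE {..<K} (\<lambda>_. UNIV :: nat set)"
  have "fst \<in> msg_law K M \<Otimes>\<^sub>M N \<rightarrow>\<^sub>M msg_law K M"
    by simp
  then have "fst \<in> msg_law K M \<Otimes>\<^sub>M N \<rightarrow>\<^sub>M count_space ?S"
    by (subst measurable_cong_sets[OF refl, of _ "msg_law K M"]) (simp_all add: sets_msg_law)
  moreover have "countable ?S"
    by (intro countable_PiE) auto
  moreover have "(\<lambda>p. f w (snd p)) \<in> measurable (msg_law K M \<Otimes>\<^sub>M N) L" for w
    using assms by (rule measurable_compose[OF measurable_snd])
  ultimately have "(\<lambda>p. f (fst p) (snd p)) \<in> measurable (msg_law K M \<Otimes>\<^sub>M N) L"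
    by (intro measurable_compose_countable'[where f = "\<lambda>w p. f w (snd p)" and g = fst and I = ?S]) auto
  then show ?thesis by (simp add: case_prod_beta')
qed

lemma prob_space_msg_law: "prob_space (msg_law K M)"
  by (intro prob_space_PiM prob_space_measure_pmf)

text \<open>Fubini for the coordinate \<open>k\<close>, but with the outer integral still over all
  message tuples: the overwritten \<open>w k\<close> integrates to total mass 1.\<close>

lemma nn_integral_msg_law_resample:
  assumes "k < K"
  shows "(\<integral>\<^sup>+w. f w \<partial>msg_law K M)
    = (\<integral>\<^sup>+w. \<integral>\<^sup>+m. f (w(k := m)) \<partial>measure_pmf (pmf_of_set {..<M k}) \<partial>msg_law K M)"
proof -
  interpret product_sigma_finite "\<lambda>k. measure_pmf (pmf_of_set {..<M k})" ..
  let ?I = "{..<K} - {k}" and ?P = "\<lambda>I. (\<Pi>\<^sub>M k\<in>I. measure_pmf (pmf_of_set {..<M k}))"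
  let ?\<mu> = "measure_pmf (pmf_of_set {..<M k})"
  have K: "{..<K} = insert k ?I" using assms by auto
  have *: "(\<integral>\<^sup>+w. f w \<partial>msg_law K M) = (\<integral>\<^sup>+w. \<integral>\<^sup>+m. f (w(k := m)) \<partial>?\<mu> \<partial>?P ?I)" for f
    using product_nn_integral_insert[of ?I k f, folded K] by (simp add: measurable_msg_law)
  show ?thesis
    by (simp add: * [of f] * [of "\<lambda>w. \<integral>\<^sup>+m. f (w(k := m)) \<partial>?\<mu>"] measure_pmf.emeasure_space_1)
qed

lemma nn_integral_msg_law_resample_uniform:
  assumes "k < K" "0 < M k"
  shows "(\<integral>\<^sup>+w. f w \<partial>msg_law K M) = (\<integral>\<^sup>+w. (\<Sum>m<M k. f (w(k := m))) / of_nat (M k) \<partial>msg_law K M)"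
proof -
  have ne: "{..<M k} \<noteq> {}" using assms(2) by auto
  show ?thesis
    unfolding nn_integral_msg_law_resample[OF assms(1), where f = f] nn_integral_pmf_of_set[OF ne finite_lessThan]
    by simp
qed

section \<open>Channel outputs\<close>

text \<open>A function of the outputs, whereas \<open>input\<close> is a function of the noises:
  densities of the outputs need the former.\<close>

definition input_at :: "code \<Rightarrow> (nat \<Rightarrow> nat) \<Rightarrow> (nat \<times> nat \<Rightarrow> real) \<Rightarrow> nat \<Rightarrow> nat \<Rightarrow> real" where
  "input_at C w y k t = enc C k t (w k) (\<lambda>s\<in>{..<t}. y (k, s))"

definition output_record ::
  "nat \<Rightarrow> real \<Rightarrow> real \<Rightarrow> code \<Rightarrow> nat \<Rightarrow> (nat \<Rightarrow> nat) \<Rightarrow> (nat \<times> nat \<Rightarrow> real) \<Rightarrow> nat \<times> nat \<Rightarrow> real" where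
  "output_record K snr inr C T w z = (\<lambda>i\<in>{..<K} \<times> {..<T}. outputs K snr inr C w z T (fst i) (snd i))"

definition measurable_encoders :: "nat \<Rightarrow> nat \<Rightarrow> code \<Rightarrow> bool" where
  "measurable_encoders K T C \<longleftrightarrow>
     (\<forall>k<K. \<forall>t<T. \<forall>m. enc C k t m \<in> borel_measurable (\<Pi>\<^sub>M s\<in>{..<t}. borel))"

lemma outputs_undefined: "t \<le> s \<Longrightarrow> outputs K snr inr C w z t k s = undefined"
  by (induction t) auto

lemma outputs_stable:
  assumes "s < t" "t \<le> T"
  shows "outputs K snr inr C w z T k s = outputs K snr inr C w z t k s"
  using assms(2) by (induction T rule: dec_induct) (use assms(1) in auto)

lemma outputs_restrict:
  assumes "t \<le> T"
  shows "outputs K snr inr C w z t k = (\<lambda>s\<in>{..<t}. outputs K snr inr C w z T k s)"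
  by (rule ext) (simp add: restrict_def outputs_undefined outputs_stable[OF _ assms])

lemma outputs_eq_channel_output:
  assumes "s < T"
  shows "outputs K snr inr C w z T k s =
    channel_output K snr inr (\<lambda>i. input K snr inr C w z i s) (\<lambda>i. z (i, s)) k"
  using assms by (subst outputs_stable[of s "Suc s"]) (auto simp: input_def)

lemma outputs_cong:
  assumes "\<And>i s. i < K \<Longrightarrow> s < t \<Longrightarrow> z (i, s) = z' (i, s)" "k < K"
  shows "outputs K snr inr C w z t k = outputs K snr inr C w z' t k"
  using assms
proof (induction t arbitrary: k)
  case (Suc t)
  have "outputs K snr inr C w z t i = outputs K snr inr C w z' t i" if "i < K" for i
    using that Suc.prems by (intro Suc.IH) auto
  then show ?case using Suc.prems by (simp add: channel_output_def)
qed auto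

lemma input_cong:
  assumes "\<And>i s. i < K \<Longrightarrow> s < t \<Longrightarrow> z (i, s) = z' (i, s)" "k < K"
  shows "input K snr inr C w z k t = input K snr inr C w z' k t"
proof -
  have "outputs K snr inr C w z t k = outputs K snr inr C w z' t k"
    by (rule outputs_cong) (use assms in auto)
  then show ?thesis by (simp add: input_def)
qed

lemma input_at_output_record:
  assumes "k < K" "t \<le> T"
  shows "input_at C w (output_record K snr inr C T w z) k t = input K snr inr C w z k t"
proof -
  have "(\<lambda>s\<in>{..<t}. output_record K snr inr C T w z (k, s)) = outputs K snr inr C w z t k"
    unfolding outputs_restrict[OF assms(2)] using assms by (intro restrict_ext) (simp add: output_record_def)
  then show ?thesis by (simp only: input_at_def input_def)
qed

lemma measurable_outputs:
  assumes "measurable_encoders K T C" "t \<le> T" "k < K"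
    and Z: "\<And>i s. i < K \<Longrightarrow> s < T \<Longrightarrow> (\<lambda>p. Z p (i, s)) \<in> borel_measurable N"
  shows "(\<lambda>p. outputs K snr inr C w (Z p) t k) \<in> measurable N (\<Pi>\<^sub>M s\<in>{..<t}. borel)"
  using assms(2,3)
proof (induction t arbitrary: k)
  case (Suc t)
  have t: "t < T" using Suc.prems by simp
  have "(\<lambda>p. enc C i t (w i) (outputs K snr inr C w (Z p) t i)) \<in> borel_measurable N"
    if "i < K" for i
    using assms(1) that t
    by (intro measurable_compose[OF Suc.IH[of i], of "enc C i t (w i)"]) (auto simp: measurable_encoders_def)
  then have "(\<lambda>p. channel_output K snr inr (\<lambda>i. enc C i t (w i) (outputs K snr inr C w (Z p) t i))
       (\<lambda>i. Z p (i, t)) k) \<in> borel_measurable N"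
    unfolding channel_output_def using Suc.prems Z t
    by (intro borel_measurable_add borel_measurable_sum borel_measurable_times borel_measurable_const) auto
  then show ?case
    unfolding outputs.simps lessThan_Suc
    using Suc.IH[OF less_imp_le[OF t] Suc.prems(2)] by (intro measurable_fun_upd[where J = "{..<t}"]) auto
qed simp

lemma measurable_input:
  assumes "measurable_encoders K T C" "t < T" "k < K"
    and "\<And>i s. i < K \<Longrightarrow> s < T \<Longrightarrow> (\<lambda>p. Z p (i, s)) \<in> borel_measurable N"
  shows "(\<lambda>p. input K snr inr C w (Z p) k t) \<in> borel_measurable N"
proof -
  have "(\<lambda>p. outputs K snr inr C w (Z p) t k) \<in> measurable N (\<Pi>\<^sub>M s\<in>{..<t}. borel)"
    by (rule measurable_outputs[OF assms(1) less_imp_le[OF assms(2)] assms(3)]) (rule assms(4))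
  moreover have "enc C k t (w k) \<in> borel_measurable (\<Pi>\<^sub>M s\<in>{..<t}. borel)"
    using assms(1-3) by (simp add: measurable_encoders_def)
  ultimately show ?thesis
    unfolding input_def by (rule measurable_compose)
qed

lemma measurable_input_at:
  assumes "measurable_encoders K T C" "t < T" "k < K"
  shows "(\<lambda>y. input_at C w y k t) \<in> borel_measurable (\<Pi>\<^sub>M i\<in>{..<K} \<times> {..<T}. borel)"
proof -
  have "(\<lambda>y. \<lambda>s\<in>{..<t}. y (k, s)) \<in> (\<Pi>\<^sub>M i\<in>{..<K} \<times> {..<T}. borel) \<rightarrow>\<^sub>M (\<Pi>\<^sub>M s\<in>{..<t}. borel :: real measure)"
    using assms(2,3) by (intro measurable_restrict measurable_component_singleton) auto
  moreover have "enc C k t (w k) \<in> borel_measurable (\<Pi>\<^sub>M s\<in>{..<t}. borel)"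
    using assms by (simp add: measurable_encoders_def)
  ultimately show ?thesis
    unfolding input_at_def by (rule measurable_compose)
qed

lemma measurable_output_record:
  assumes "measurable_encoders K T C"
  shows "output_record K snr inr C T w \<in> (\<Pi>\<^sub>M i\<in>{..<K} \<times> {..<T}. borel) \<rightarrow>\<^sub>M (\<Pi>\<^sub>M i\<in>{..<K} \<times> {..<T}. borel)"
proof -
  have "(\<lambda>z. outputs K snr inr C w z T (fst i) (snd i)) \<in> borel_measurable (\<Pi>\<^sub>M i\<in>{..<K} \<times> {..<T}. borel)"
    if "i \<in> {..<K} \<times> {..<T}" for i
  proof -
    have "(\<lambda>z. outputs K snr inr C w z T (fst i)) \<in> (\<Pi>\<^sub>M i\<in>{..<K} \<times> {..<T}. borel) \<rightarrow>\<^sub>M (\<Pi>\<^sub>M s\<in>{..<T}. borel)"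
      using that by (intro measurable_outputs[OF assms, where Z = "\<lambda>z. z"] measurable_component_singleton) auto
    from measurable_compose[OF this measurable_component_singleton[of "snd i"]]
    show ?thesis using that by auto
  qed
  then show ?thesis
    unfolding output_record_def by (rule measurable_restrict)
qed

text \<open>For fixed messages each output is its own noise plus a function of strictly earlier
  noises, so noises and outputs are related by a triangular shift ranked by time.\<close>

lemma nn_integral_output_record:
  assumes "measurable_encoders K T C" "f \<in> borel_measurable (\<Pi>\<^sub>M i\<in>{..<K} \<times> {..<T}. borel)"
  shows "(\<integral>\<^sup>+z. f (output_record K snr inr C T w z) \<partial>(\<Pi>\<^sub>M i\<in>{..<K} \<times> {..<T}. lborel))
    = (\<integral>\<^sup>+y. f y \<partial>(\<Pi>\<^sub>M i\<in>{..<K} \<times> {..<T}. lborel))"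
proof -
  \<comment> \<open>The output without its own noise; through the feedback it depends on earlier
    noises only.\<close>
  define s where "s i z = channel_output K snr inr (\<lambda>j. input K snr inr C w z j (snd i)) (\<lambda>_. 0) (fst i)"
    for i :: "nat \<times> nat" and z
  have "output_record K snr inr C T w z = (\<lambda>i\<in>{..<K} \<times> {..<T}. z i + s i z)" for z
    by (auto simp: fun_eq_iff output_record_def outputs_eq_channel_output s_def channel_output_def restrict_def)
  moreover have "(\<integral>\<^sup>+z. f (\<lambda>i\<in>{..<K} \<times> {..<T}. z i + s i z) \<partial>(\<Pi>\<^sub>M i\<in>{..<K} \<times> {..<T}. lborel))
    = (\<integral>\<^sup>+y. f y \<partial>(\<Pi>\<^sub>M i\<in>{..<K} \<times> {..<T}. lborel))"
  proof (rule nn_integral_PiM_triangular_shift[where r = snd, OF _ _ _ assms(2)])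
    fix i assume i: "i \<in> {..<K} \<times> {..<T}"
    show "s i \<in> borel_measurable (\<Pi>\<^sub>M i\<in>{..<K} \<times> {..<T}. borel)"
      unfolding s_def channel_output_def using i
      by (intro borel_measurable_add borel_measurable_sum borel_measurable_times borel_measurable_const
          measurable_input[OF assms(1), where Z = "\<lambda>z. z"] measurable_component_singleton) auto
    fix z z' :: "nat \<times> nat \<Rightarrow> real"
    assume eq: "\<And>j. j \<in> {..<K} \<times> {..<T} \<Longrightarrow> snd j < snd i \<Longrightarrow> z j = z' j"
    have "input K snr inr C w z j (snd i) = input K snr inr C w z' j (snd i)" if "j < K" for j
      using i by (intro input_cong[OF _ that] eq) auto
    then show "s i z = s i z'"
      using i unfolding s_def channel_output_def
      by (auto intro!: sum.cong arg_cong2[where f = "(+)"])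
  qed auto
  ultimately show ?thesis by simp
qed

section \<open>Residuals of the outputs\<close>

text \<open>What is left of \<open>y (0, t)\<close> when all inputs but that of user
  \<open>1\<close> are subtracted: at the actual outputs, \<open>sqrt inr\<close> times that input
  plus \<open>z (0, t)\<close>.\<close>

definition interference_plus_noise ::
  "nat \<Rightarrow> real \<Rightarrow> real \<Rightarrow> code \<Rightarrow> (nat \<Rightarrow> nat) \<Rightarrow> (nat \<times> nat \<Rightarrow> real) \<Rightarrow> nat \<Rightarrow> real" where
  "interference_plus_noise K snr inr C w y t =
     y (0, t) - sqrt snr * input_at C w y 0 t - sqrt inr * (\<Sum>i\<in>{..<K} - {0, 1}. input_at C w y i t)"

text \<open>Prediction errors of the comparison model. Output \<open>1\<close> contains the input of
  user \<open>1\<close> with gain \<open>sqrt snr\<close>, hence the factor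
  \<open>sqrt snr / sqrt inr\<close>; the later outputs contain it with gain
  \<open>sqrt inr\<close>. The form \<open>y (k, t)\<close> plus a correction exhibits a triangular
  shift.\<close>

definition residual ::
  "nat \<Rightarrow> real \<Rightarrow> real \<Rightarrow> code \<Rightarrow> (nat \<Rightarrow> nat) \<Rightarrow> (nat \<times> nat \<Rightarrow> real) \<Rightarrow> nat \<times> nat \<Rightarrow> real" where
  "residual K snr inr C w y = (\<lambda>(k, t). y (k, t) +
     (if k = 0 then 0
      else if k = 1 then
        - sqrt inr * (\<Sum>i\<in>{..<K} - {1}. input_at C w y i t)
        - sqrt snr / sqrt inr * interference_plus_noise K snr inr C w y t
      else
        - sqrt snr * input_at C w y k t - sqrt inr * (\<Sum>i\<in>{..<K} - {1, k}. input_at C w y i t)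
        - interference_plus_noise K snr inr C w y t))"

text \<open>Standard deviations in the comparison model. From \<open>k = 2\<close> on the actual
  residual is a difference of two unit noises, of variance 2; using scale 1 there only changes an
  additive constant of the bound.\<close>

definition residual_scale :: "real \<Rightarrow> real \<Rightarrow> nat \<times> nat \<Rightarrow> real" where
  "residual_scale snr inr = (\<lambda>(k, t).
     if k = 0 then sqrt (1 + snr + inr) else if k = 1 then sqrt (1 + snr / inr) else 1)"

lemma residual_scale_ge_1:
  assumes "0 \<le> snr" "0 \<le> inr"
  shows "1 \<le> residual_scale snr inr i"
  using assms by (auto simp: residual_scale_def split: prod.split)

lemma input_at_cong:
  assumes "\<And>s. s < t \<Longrightarrow> y (k, s) = y' (k, s)"
  shows "input_at C w y k t = input_at C w y' k t"
proof -
  have "(\<lambda>s\<in>{..<t}. y (k, s)) = (\<lambda>s\<in>{..<t}. y' (k, s))"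
    using assms by (intro restrict_ext) auto
  then show ?thesis by (simp only: input_at_def)
qed

lemma input_at_fun_upd: "k \<noteq> j \<Longrightarrow> input_at C (w(j := m)) y k t = input_at C w y k t"
  by (simp add: input_at_def)

text \<open>The predictor never uses the input of user \<open>1\<close>; this allows summing over
  the values of \<open>w 1\<close> under the comparison density.\<close>

lemma residual_fun_upd:
  assumes "2 \<le> K"
  shows "residual K snr inr C (w(1 := m)) y = residual K snr inr C w y"
proof -
  have sums: "(\<Sum>i\<in>{..<K} - A. input_at C (w(1 := m)) y i t) = (\<Sum>i\<in>{..<K} - A. input_at C w y i t)"
    if "1 \<in> A" for A t
    using that by (intro sum.cong refl input_at_fun_upd) auto
  have "interference_plus_noise K snr inr C (w(1 := m)) y t = interference_plus_noise K snr inr C w y t" for t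
    by (simp add: interference_plus_noise_def sums input_at_fun_upd)
  then show ?thesis
    by (auto simp: residual_def fun_eq_iff sums input_at_fun_upd)
qed

lemma outputs_eq_output_record:
  assumes "k < K"
  shows "outputs K snr inr C w z T k = (\<lambda>s\<in>{..<T}. output_record K snr inr C T w z (k, s))"
  using assms by (subst outputs_restrict[OF order_refl]) (auto simp: output_record_def intro!: restrict_ext)

lemma output_record_eq:
  assumes "k < K" "t < T"
  shows "output_record K snr inr C T w z (k, t) = sqrt snr * input K snr inr C w z k t
    + sqrt inr * (\<Sum>i\<in>{..<K} - {k}. input K snr inr C w z i t) + z (k, t)"
  using assms by (simp add: output_record_def outputs_eq_channel_output channel_output_def sum_distrib_left)

text \<open>At the actual outputs the input of user \<open>1\<close> cancels, and beyond receiver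
  \<open>0\<close> only noises remain.\<close>

lemma residual_output_record:
  fixes z :: "nat \<times> nat \<Rightarrow> real"
  assumes "2 \<le> K" "0 < inr" "k < K" "t < T"
  shows "residual K snr inr C w (output_record K snr inr C T w z) (k, t) =
    (if k = 0 then output_record K snr inr C T w z (0, t)
     else if k = 1 then z (1, t) - sqrt snr / sqrt inr * z (0, t)
     else z (k, t) - z (0, t))"
proof -
  let ?x = "\<lambda>i. input K snr inr C w z i t"
  let ?y = "output_record K snr inr C T w z"
  have x: "input_at C w ?y i t = ?x i" if "i < K" for i
    using that assms(4) by (simp add: input_at_output_record)
  have split: "(\<Sum>i\<in>{..<K} - {j}. ?x i) = ?x 1 + (\<Sum>i\<in>{..<K} - {1, j}. ?x i)" if "j \<noteq> 1" for j
    using that assms(1) unfolding Diff_insert[of "{..<K}" 1 "{j}"] by (intro sum.remove) auto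
  have sums: "(\<Sum>i\<in>{..<K} - A. input_at C w ?y i t) = (\<Sum>i\<in>{..<K} - A. ?x i)" for A
    by (intro sum.cong) (auto simp: x)
  have u: "interference_plus_noise K snr inr C w ?y t = sqrt inr * ?x 1 + z (0, t)"
    using assms split[of 0]
    by (simp add: interference_plus_noise_def sums x output_record_eq algebra_simps insert_commute)
  show ?thesis
    using assms split[of k]
    by (simp add: residual_def u sums x output_record_eq algebra_simps)
qed

lemma measurable_interference_plus_noise:
  assumes "measurable_encoders K T C" "t < T" "2 \<le> K"
  shows "(\<lambda>y. interference_plus_noise K snr inr C w y t) \<in> borel_measurable (\<Pi>\<^sub>M i\<in>{..<K} \<times> {..<T}. borel)"
  unfolding interference_plus_noise_def using assms
  by (intro borel_measurable_diff borel_measurable_times borel_measurable_const borel_measurable_sum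
      measurable_input_at[OF assms(1)] measurable_component_singleton) auto

lemma measurable_residual:
  assumes "measurable_encoders K T C" "2 \<le> K" "k < K" "t < T"
  shows "(\<lambda>y. residual K snr inr C w y (k, t)) \<in> borel_measurable (\<Pi>\<^sub>M i\<in>{..<K} \<times> {..<T}. borel)"
proof -
  have [measurable]: "(\<lambda>y. \<Sum>i\<in>{..<K} - A. input_at C w y i t) \<in> borel_measurable (\<Pi>\<^sub>M i\<in>{..<K} \<times> {..<T}. borel)" for A
    using assms by (intro borel_measurable_sum measurable_input_at[OF assms(1)]) auto
  have [measurable]: "(\<lambda>y. y (k, t)) \<in> borel_measurable (\<Pi>\<^sub>M i\<in>{..<K} \<times> {..<T}. borel :: real measure)"
    using assms by (intro measurable_component_singleton) auto
  note [measurable] = measurable_interference_plus_noise[OF assms(1,4,2)] measurable_input_at[OF assms(1,4,3)]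
  show ?thesis unfolding residual_def prod.case by measurable
qed

text \<open>A second triangular shift: the corrections read past outputs and, for receivers other
  than \<open>0\<close>, the present output of receiver \<open>0\<close>. Hence a density in the
  residuals is a density in the outputs.\<close>

lemma nn_integral_residual:
  assumes "measurable_encoders K T C" "2 \<le> K"
    and f: "f \<in> borel_measurable (\<Pi>\<^sub>M i\<in>{..<K} \<times> {..<T}. borel)"
  shows "(\<integral>\<^sup>+y. f (\<lambda>i\<in>{..<K} \<times> {..<T}. residual K snr inr C w y i) \<partial>(\<Pi>\<^sub>M i\<in>{..<K} \<times> {..<T}. lborel))
    = (\<integral>\<^sup>+y. f y \<partial>(\<Pi>\<^sub>M i\<in>{..<K} \<times> {..<T}. lborel))"
proof -
  define s where "s i y = residual K snr inr C w y i - y i" for i y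
  \<comment> \<open>Within one channel use, the output of receiver \<open>0\<close> comes first.\<close>
  define r where "r = (\<lambda>(k :: nat, t :: nat). 2 * t + (if k = 0 then 0 else 1))"
  have "(\<integral>\<^sup>+y. f (\<lambda>i\<in>{..<K} \<times> {..<T}. y i + s i y) \<partial>(\<Pi>\<^sub>M i\<in>{..<K} \<times> {..<T}. lborel))
    = (\<integral>\<^sup>+y. f y \<partial>(\<Pi>\<^sub>M i\<in>{..<K} \<times> {..<T}. lborel))"
  proof (rule nn_integral_PiM_triangular_shift[where r = r, OF _ _ _ f])
    show "s i \<in> borel_measurable (\<Pi>\<^sub>M i\<in>{..<K} \<times> {..<T}. borel)" if "i \<in> {..<K} \<times> {..<T}" for i
      unfolding s_def using that measurable_residual[OF assms(1,2), of "fst i" "snd i"]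
      by (intro borel_measurable_diff measurable_component_singleton) auto
    show "s i y = s i y'" if i: "i \<in> {..<K} \<times> {..<T}"
      and eq: "\<And>j. j \<in> {..<K} \<times> {..<T} \<Longrightarrow> r j < r i \<Longrightarrow> y j = y' j" for i y y'
    proof -
      obtain k t where kt: "i = (k, t)" "k < K" "t < T" using i by auto
      have x: "input_at C w y j t = input_at C w y' j t" if "j < K" for j
        using that kt by (intro input_at_cong eq) (auto simp: r_def)
      then have sums: "(\<Sum>j\<in>{..<K} - A. input_at C w y j t) = (\<Sum>j\<in>{..<K} - A. input_at C w y' j t)" for A
        by (intro sum.cong) auto
      have "y (0, t) = y' (0, t)" if "k \<noteq> 0"
        using that kt by (intro eq) (auto simp: r_def)
      then have "interference_plus_noise K snr inr C w y t = interference_plus_noise K snr inr C w y' t" if "k \<noteq> 0"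
        using that assms(2) by (simp add: interference_plus_noise_def sums x)
      then show ?thesis by (auto simp: s_def residual_def kt sums x)
    qed
  qed auto
  then show ?thesis by (simp add: s_def)
qed

section \<open>Correct decoding under the comparison density\<close>

text \<open>The comparison density times \<open>(2 * pi) powr (K * T / 2)\<close>. As
  \<open>std_normal_density\<close> is at most \<open>1 / sqrt (2 * pi)\<close>, this is a lower
  bound for the ratio of the comparison density to the noise density.\<close>

definition residual_likelihood ::
  "nat \<Rightarrow> real \<Rightarrow> real \<Rightarrow> code \<Rightarrow> nat \<Rightarrow> (nat \<Rightarrow> nat) \<Rightarrow> (nat \<times> nat \<Rightarrow> real) \<Rightarrow> real" where
  "residual_likelihood K snr inr C T w y = (\<Prod>i\<in>{..<K} \<times> {..<T}.
     exp (- (residual K snr inr C w y i)\<^sup>2 / (2 * (residual_scale snr inr i)\<^sup>2)) / residual_scale snr inr i)"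

definition decodes :: "code \<Rightarrow> nat \<Rightarrow> nat \<Rightarrow> nat \<Rightarrow> (nat \<times> nat \<Rightarrow> real) \<Rightarrow> bool" where
  "decodes C T k m y \<longleftrightarrow> dec C k (\<lambda>s\<in>{..<T}. y (k, s)) = m"

lemma measurable_decodes:
  assumes "dec C k \<in> (\<Pi>\<^sub>M s\<in>{..<T}. borel) \<rightarrow>\<^sub>M count_space UNIV" "k < K"
  shows "Measurable.pred (\<Pi>\<^sub>M i\<in>{..<K} \<times> {..<T}. borel) (decodes C T k m)"
proof -
  have "(\<lambda>y. \<lambda>s\<in>{..<T}. y (k, s)) \<in> (\<Pi>\<^sub>M i\<in>{..<K} \<times> {..<T}. borel) \<rightarrow>\<^sub>M (\<Pi>\<^sub>M s\<in>{..<T}. borel :: real measure)"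
    using assms(2) by (intro measurable_restrict measurable_component_singleton) auto
  from measurable_compose[OF this assms(1)]
  have "(\<lambda>y. dec C k (\<lambda>s\<in>{..<T}. y (k, s))) \<in> (\<Pi>\<^sub>M i\<in>{..<K} \<times> {..<T}. borel) \<rightarrow>\<^sub>M count_space UNIV" .
  then show ?thesis
    unfolding decodes_def by (rule pred_eq_const1) auto
qed

text \<open>The noise density is bounded by its value at \<open>0\<close>, which is the missing
  normalising factor of the Gaussian on the right.\<close>

lemma std_normal_density_times_exp_le:
  assumes "0 < s"
  shows "std_normal_density x * (exp (- v\<^sup>2 / (2 * s\<^sup>2)) / s) \<le> normal_density 0 s v"
proof -
  have "exp (- x\<^sup>2 / 2) * (exp (- v\<^sup>2 / (2 * s\<^sup>2)) / s) \<le> 1 * (exp (- v\<^sup>2 / (2 * s\<^sup>2)) / s)"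
    using assms by (intro mult_right_mono) auto
  then have "(1 / sqrt (2 * pi)) * (exp (- x\<^sup>2 / 2) * (exp (- v\<^sup>2 / (2 * s\<^sup>2)) / s))
      \<le> (1 / sqrt (2 * pi)) * (exp (- v\<^sup>2 / (2 * s\<^sup>2)) / s)"
    by (intro mult_left_mono) auto
  then show ?thesis
    using assms by (simp add: normal_density_def std_normal_density_def real_sqrt_mult field_simps)
qed

lemma sum_indicator_eq_le:
  fixes c :: ennreal and n :: nat
  shows "(\<Sum>m<n. c * (if a = m then 1 else 0)) \<le> c"
proof -
  have "(\<Sum>m<n. c * (if a = m then 1 else 0)) = c * (\<Sum>m<n. if a = m then 1 else 0)"
    by (simp only: sum_distrib_left)
  also have "\<dots> \<le> c * 1" by (intro mult_left_mono) auto
  finally show ?thesis by simp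
qed

text \<open>A change of measure from the noises to the comparison density of the outputs. Averaging
  over \<open>w 1\<close> gains a factor \<open>1 / msgs C 1\<close>, as receiver \<open>1\<close>
  names one message and the density ignores \<open>w 1\<close>. In residual coordinates only the
  decision of receiver \<open>0\<close> is left, and averaging over \<open>w 0\<close> gains
  \<open>1 / msgs C 0\<close>.\<close>

lemma nn_integral_correct_residual_likelihood_le:
  assumes K: "2 \<le> K" and snr: "0 \<le> snr" "0 < inr" and enc: "measurable_encoders K T C"
    and dec: "\<And>k. k < 2 \<Longrightarrow> dec C k \<in> (\<Pi>\<^sub>M s\<in>{..<T}. borel) \<rightarrow>\<^sub>M count_space UNIV"
    and M: "0 < msgs C 0" "0 < msgs C 1"
  shows "(\<integral>\<^sup>+(w, z). ennreal (residual_likelihood K snr inr C T w (output_record K snr inr C T w z)) *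
      (if decodes C T 0 (w 0) (output_record K snr inr C T w z) \<and> decodes C T 1 (w 1) (output_record K snr inr C T w z)
       then 1 else 0) \<partial>msg_noise K T C) \<le> 1 / of_nat (msgs C 0) / of_nat (msgs C 1)"
proof -
  let ?I = "{..<K} \<times> {..<T}"
  let ?L = "\<Pi>\<^sub>M i\<in>?I. lborel :: real measure"
  let ?B = "\<Pi>\<^sub>M i\<in>?I. borel :: real measure"
  let ?Y = "output_record K snr inr C T"
  let ?s = "residual_scale snr inr"
  let ?r = "residual K snr inr C"
  let ?M = "msg_law K (msgs C)"
  define D where "D v = (\<Prod>i\<in>?I. normal_density 0 (?s i) (v i))" for v
  define G where "G w y = ennreal (D (?r w y)) * (if decodes C T 0 (w 0) y then 1 else 0)" for w y
  define F where "F w y = G w y * (if decodes C T 1 (w 1) y then 1 else 0)" for w y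
  have s: "0 < ?s i" for i
    using residual_scale_ge_1[of snr inr i] snr by linarith
  have mdec [measurable]: "Measurable.pred ?B (decodes C T 0 m)" "Measurable.pred ?B (decodes C T 1 m)" for m
    using K by (auto intro!: measurable_decodes dec)
  have mr: "(\<lambda>y. ?r w y i) \<in> borel_measurable ?B" if "i \<in> ?I" for w i
    using measurable_residual[OF enc K, of "fst i" "snd i"] that by auto
  have [measurable]: "(\<lambda>y. D (?r w y)) \<in> borel_measurable ?B" for w
    unfolding D_def by (intro borel_measurable_prod measurable_compose[OF mr borel_measurable_normal_density])
  have [measurable]: "D \<in> borel_measurable ?B"
    unfolding D_def
    by (intro borel_measurable_prod measurable_compose[OF _ borel_measurable_normal_density] measurable_component_singleton)
  have D_restrict: "D (\<lambda>i\<in>?I. v i) = D v" for v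
    unfolding D_def by (intro prod.cong) auto
  have mG [measurable]: "G w \<in> borel_measurable ?B" for w
    unfolding G_def by measurable
  have mF [measurable]: "F w \<in> borel_measurable ?B" for w
    unfolding F_def by measurable
  define l where "l w z = residual_likelihood K snr inr C T w (?Y w z)" for w z
  define c where "c w z = (if decodes C T 0 (w 0) (?Y w z) \<and> decodes C T 1 (w 1) (?Y w z) then 1 else 0 :: ennreal)" for w z
  have mY: "?Y w \<in> ?B \<rightarrow>\<^sub>M ?B" for w
    by (rule measurable_output_record[OF enc])
  have "residual_likelihood K snr inr C T w \<in> borel_measurable ?B" for w
    unfolding residual_likelihood_def
  proof (rule borel_measurable_prod)
    fix i assume "i \<in> ?I"
    note [measurable] = mr[OF this]
    show "(\<lambda>y. exp (- (?r w y i)\<^sup>2 / (2 * (?s i)\<^sup>2)) / ?s i) \<in> borel_measurable ?B"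
      by measurable
  qed
  then have [measurable]: "l w \<in> borel_measurable ?B" for w
    unfolding l_def by (rule measurable_compose[OF mY])
  have [measurable]: "c w \<in> borel_measurable ?B" for w
    using measurable_compose[OF mY mdec(1)] measurable_compose[OF mY mdec(2)]
    unfolding c_def by measurable
  have setsN: "sets (noise_law K T) = sets ?B"
    by (intro sets_PiM_cong) auto
  interpret N: prob_space "noise_law K T"
    by (intro prob_space_PiM prob_space_normal_density) simp
  interpret M: prob_space ?M by (rule prob_space_msg_law)
  have m1: "(\<lambda>z. ennreal (l w z) * c w z) \<in> borel_measurable (noise_law K T)" for w
    unfolding measurable_cong_sets[OF setsN refl] by measurable
  have noise: "(\<integral>\<^sup>+z. ennreal (l w z) * c w z \<partial>noise_law K T) \<le> (\<integral>\<^sup>+y. F w y \<partial>?L)" for w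
  proof -
    have "(\<integral>\<^sup>+z. ennreal (l w z) * c w z \<partial>noise_law K T)
      = (\<integral>\<^sup>+z. ennreal (\<Prod>i\<in>?I. std_normal_density (z i)) * (ennreal (l w z) * c w z) \<partial>?L)"
      by (subst PiM_density_lborel) (auto intro!: nn_integral_density prob_space_normal_density simp: measurable_PiM_lborel)
    also have "\<dots> \<le> (\<integral>\<^sup>+z. F w (?Y w z) \<partial>?L)"
    proof (rule nn_integral_mono)
      fix z
      have "(\<Prod>i\<in>?I. std_normal_density (z i)) * l w z \<le> D (?r w (?Y w z))"
        unfolding l_def residual_likelihood_def D_def prod.distrib[symmetric]
        by (intro prod_mono conjI std_normal_density_times_exp_le s mult_nonneg_nonneg divide_nonneg_pos) auto
      moreover have "0 \<le> l w z"
        unfolding l_def residual_likelihood_def by (intro prod_nonneg ballI divide_nonneg_pos s) auto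
      ultimately show "ennreal (\<Prod>i\<in>?I. std_normal_density (z i)) * (ennreal (l w z) * c w z) \<le> F w (?Y w z)"
        by (auto simp: F_def G_def c_def simp flip: ennreal_mult'' intro!: ennreal_leI)
    qed
    also have "\<dots> = (\<integral>\<^sup>+y. F w y \<partial>?L)"
      by (rule nn_integral_output_record[OF enc mF])
    finally show ?thesis .
  qed
  define H where "H m = (\<integral>\<^sup>+v. ennreal (D v) * (if decodes C T 0 m v then 1 else 0) \<partial>?L)" for m
  \<comment> \<open>The residual of receiver \<open>0\<close> is its output, so its decision
    survives the passage to residuals, while all inputs disappear: of the messages, only
    \<open>w 0\<close> remains.\<close>
  have GH: "(\<integral>\<^sup>+y. G w y \<partial>?L) = H (w 0)" for w
  proof -
    have dr: "decodes C T 0 m (\<lambda>i\<in>?I. ?r w y i) = decodes C T 0 m y" for m y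
    proof -
      have "(\<lambda>s\<in>{..<T}. (\<lambda>i\<in>?I. ?r w y i) (0, s)) = (\<lambda>s\<in>{..<T}. y (0, s))"
        using K by (intro restrict_ext) (auto simp: residual_def)
      then show ?thesis by (simp only: decodes_def)
    qed
    have "(\<integral>\<^sup>+y. G w y \<partial>?L) = (\<integral>\<^sup>+y. (\<lambda>v. ennreal (D v) * (if decodes C T 0 (w 0) v then 1 else 0)) (\<lambda>i\<in>?I. ?r w y i) \<partial>?L)"
      by (simp only: G_def D_restrict dr)
    also have "\<dots> = H (w 0)"
      unfolding H_def by (intro nn_integral_residual[OF enc K]) measurable
    finally show ?thesis .
  qed
  have F1: "(\<Sum>m<msgs C 1. \<integral>\<^sup>+y. F (w(1 := m)) y \<partial>?L) \<le> H (w 0)" for w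
  proof -
    \<comment> \<open>\<open>G\<close> does not see \<open>w 1\<close>, so the sum over
      \<open>m\<close> concerns the decision of receiver \<open>1\<close> alone.\<close>
    have eq: "F (w(1 := m)) y = G w y * (if decodes C T 1 m y then 1 else 0)" for m y
      by (simp add: F_def G_def residual_fun_upd[OF K, simplified])
    have "(\<Sum>m<msgs C 1. \<integral>\<^sup>+y. F (w(1 := m)) y \<partial>?L)
      = (\<integral>\<^sup>+y. (\<Sum>m<msgs C 1. G w y * (if decodes C T 1 m y then 1 else 0)) \<partial>?L)"
      unfolding eq by (rule nn_integral_sum[symmetric]) (unfold measurable_PiM_lborel, measurable)
    also have "\<dots> \<le> (\<integral>\<^sup>+y. G w y \<partial>?L)"
      unfolding decodes_def by (intro nn_integral_mono sum_indicator_eq_le)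
    finally show ?thesis by (simp only: GH)
  qed
  have H1: "(\<Sum>m<msgs C 0. H m) \<le> 1"
  proof -
    have "(\<Sum>m<msgs C 0. H m) = (\<integral>\<^sup>+v. (\<Sum>m<msgs C 0. ennreal (D v) * (if decodes C T 0 m v then 1 else 0)) \<partial>?L)"
      unfolding H_def by (rule nn_integral_sum[symmetric]) (unfold measurable_PiM_lborel, measurable)
    also have "\<dots> \<le> (\<integral>\<^sup>+v. ennreal (D v) \<partial>?L)"
      unfolding decodes_def by (intro nn_integral_mono sum_indicator_eq_le)
    also have "\<dots> = (\<integral>\<^sup>+v. (\<Prod>i\<in>?I. ennreal (normal_density 0 (?s i) (v i))) \<partial>?L)"
      by (simp add: D_def prod_ennreal)
    also have "\<dots> = (\<Prod>i\<in>?I. \<integral>\<^sup>+x. ennreal (normal_density 0 (?s i) x) \<partial>lborel)"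
    proof -
      interpret product_sigma_finite "\<lambda>_::nat \<times> nat. lborel :: real measure" ..
      show ?thesis by (intro product_nn_integral_prod) auto
    qed
    also have "\<dots> = 1"
    proof -
      have "(\<integral>\<^sup>+x. ennreal (normal_density 0 (?s i) x) \<partial>lborel) = 1" for i
        using prob_space.emeasure_space_1[OF prob_space_normal_density[OF s[of i], of 0]]
        by (simp add: emeasure_density)
      then show ?thesis by simp
    qed
    finally show ?thesis .
  qed
  have "(\<integral>\<^sup>+(w, z). ennreal (l w z) * c w z \<partial>msg_noise K T C)
    = (\<integral>\<^sup>+w. \<integral>\<^sup>+z. ennreal (l w z) * c w z \<partial>noise_law K T \<partial>?M)"
    unfolding msg_noise_def
    using N.nn_integral_fst[OF measurable_msg_law_pair[OF m1], symmetric] by simp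
  also have "\<dots> \<le> (\<integral>\<^sup>+w. \<integral>\<^sup>+y. F w y \<partial>?L \<partial>?M)"
    by (intro nn_integral_mono noise)
  also have "\<dots> = (\<integral>\<^sup>+w. (\<Sum>m<msgs C 1. \<integral>\<^sup>+y. F (w(1 := m)) y \<partial>?L) / of_nat (msgs C 1) \<partial>?M)"
    using K M by (subst nn_integral_msg_law_resample_uniform[of 1]) auto
  also have "\<dots> \<le> (\<integral>\<^sup>+w. H (w 0) / of_nat (msgs C 1) \<partial>?M)"
    by (intro nn_integral_mono divide_right_mono_ennreal F1)
  also have "\<dots> = (\<integral>\<^sup>+w. (\<Sum>m<msgs C 0. H m / of_nat (msgs C 1)) / of_nat (msgs C 0) \<partial>?M)"
    using K M by (subst nn_integral_msg_law_resample_uniform[of 0]) auto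
  also have "\<dots> = (\<Sum>m<msgs C 0. H m) / of_nat (msgs C 0) / of_nat (msgs C 1)"
    by (simp add: M.emeasure_space_1 divide_ennreal_def sum_distrib_right[symmetric] mult_ac)
  also have "\<dots> \<le> 1 / of_nat (msgs C 0) / of_nat (msgs C 1)"
    by (intro divide_right_mono_ennreal H1)
  finally show ?thesis by (simp only: l_def c_def)
qed

section \<open>A second-moment bound for the log-likelihood\<close>

text \<open>Bounds minus the logarithm of \<open>residual_likelihood\<close>. Per channel use, its
  terms account for the scales, for the squared output of receiver \<open>0\<close>, and for the
  squares of the other residuals. Its expectation involves only powers of inputs and noises.\<close>

definition cost :: "nat \<Rightarrow> real \<Rightarrow> real \<Rightarrow> code \<Rightarrow> nat \<Rightarrow> (nat \<Rightarrow> nat) \<Rightarrow> (nat \<times> nat \<Rightarrow> real) \<Rightarrow> real" where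
  "cost K snr inr C T w z = (\<Sum>t<T.
     (ln (1 + snr + inr) + ln (1 + snr / inr)) / 2
     + 3 * real K / 2 * ((\<Sum>i<K. (input K snr inr C w z i t)\<^sup>2) + (z (0, t))\<^sup>2)
     + (\<Sum>k<K. (z (k, t))\<^sup>2 + (z (0, t))\<^sup>2))"

lemma three_squares: "(a + b + c)\<^sup>2 \<le> 3 * (a\<^sup>2 + b\<^sup>2 + c\<^sup>2)" for a b c :: real
proof -
  have "0 \<le> (a - b)\<^sup>2 + (b - c)\<^sup>2 + (a - c)\<^sup>2" by simp
  then show ?thesis by (simp add: power2_eq_square algebra_simps)
qed

text \<open>Feedback correlates the inputs, so Cauchy-Schwarz is used for every realization. It
  costs a factor \<open>3 * K\<close>; the factor \<open>1 + snr + inr\<close> cancels against the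
  squared scale of receiver \<open>0\<close>.\<close>

lemma output_power_le:
  fixes x :: "nat \<Rightarrow> real"
  assumes "1 \<le> K" "0 \<le> snr" "0 \<le> inr"
  shows "(sqrt snr * x 0 + sqrt inr * (\<Sum>i\<in>{..<K} - {0}. x i) + z)\<^sup>2
    \<le> 3 * real K * (1 + snr + inr) * ((\<Sum>i<K. (x i)\<^sup>2) + z\<^sup>2)"
proof -
  let ?X = "\<Sum>i<K. (x i)\<^sup>2"
  have X0: "0 \<le> ?X" by (intro sum_nonneg) auto
  have x0: "(x 0)\<^sup>2 \<le> ?X"
    using assms(1) by (intro member_le_sum) auto
  have "(\<Sum>i\<in>{..<K} - {0}. x i)\<^sup>2 \<le> (\<Sum>i\<in>{..<K} - {0}. (x i)\<^sup>2) * card ({..<K} - {0})"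
    by (rule sum_squared_le_sum_of_squares)
  also have "\<dots> \<le> ?X * K"
    using assms(1) by (intro mult_mono sum_mono2 sum_nonneg) auto
  finally have S: "(\<Sum>i\<in>{..<K} - {0}. x i)\<^sup>2 \<le> K * ?X" by (simp add: mult.commute)
  have "(sqrt snr * x 0 + sqrt inr * (\<Sum>i\<in>{..<K} - {0}. x i) + z)\<^sup>2
    \<le> 3 * (snr * (x 0)\<^sup>2 + inr * (\<Sum>i\<in>{..<K} - {0}. x i)\<^sup>2 + z\<^sup>2)"
    using three_squares[of "sqrt snr * x 0" "sqrt inr * (\<Sum>i\<in>{..<K} - {0}. x i)" z] assms
    by (simp add: power_mult_distrib)
  also have "\<dots> \<le> 3 * (snr * (K * (?X + z\<^sup>2)) + inr * (K * (?X + z\<^sup>2)) + K * (?X + z\<^sup>2))"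
  proof -
    have K1: "?X + z\<^sup>2 \<le> K * (?X + z\<^sup>2)"
      using mult_right_mono[of 1 "real K" "?X + z\<^sup>2"] assms(1) X0 by simp
    have "(x 0)\<^sup>2 \<le> K * (?X + z\<^sup>2)" "z\<^sup>2 \<le> K * (?X + z\<^sup>2)"
      using K1 x0 X0 zero_le_power2[of z] by linarith+
    moreover have "(\<Sum>i\<in>{..<K} - {0}. x i)\<^sup>2 \<le> K * (?X + z\<^sup>2)"
      using S by (simp add: distrib_left add.commute add_increasing)
    ultimately show ?thesis
      using assms by (intro mult_left_mono add_mono) auto
  qed
  also have "\<dots> = 3 * real K * (1 + snr + inr) * (?X + z\<^sup>2)"
    by (simp add: algebra_simps)
  finally show ?thesis .
qed

lemma residual_likelihood_ge:
  assumes K: "2 \<le> K" and "0 \<le> snr" "0 < inr"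
  shows "exp (- cost K snr inr C T w z) \<le> residual_likelihood K snr inr C T w (output_record K snr inr C T w z)"
proof -
  let ?s = "residual_scale snr inr"
  let ?v = "residual K snr inr C w (output_record K snr inr C T w z)"
  let ?x = "input K snr inr C w z"
  have s: "0 < ?s i" for i
    using residual_scale_ge_1[of snr inr i] assms by linarith
  have "exp (- a / b) / c = exp (- (a / b + ln c))" if "0 < c" for a b c :: real
    using that exp_diff[of "- (a / b)" "ln c"] by simp
  then have "residual_likelihood K snr inr C T w (output_record K snr inr C T w z)
      = (\<Prod>i\<in>{..<K} \<times> {..<T}. exp (- ((?v i)\<^sup>2 / (2 * (?s i)\<^sup>2) + ln (?s i))))"
    unfolding residual_likelihood_def
    using s by (intro prod.cong) auto
  also have "\<dots> = exp (- (\<Sum>i\<in>{..<K} \<times> {..<T}. (?v i)\<^sup>2 / (2 * (?s i)\<^sup>2) + ln (?s i)))"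
    by (simp add: exp_sum flip: sum_negf)
  also have "(\<Sum>i\<in>{..<K} \<times> {..<T}. (?v i)\<^sup>2 / (2 * (?s i)\<^sup>2) + ln (?s i))
      = (\<Sum>t<T. \<Sum>k<K. (?v (k, t))\<^sup>2 / (2 * (?s (k, t))\<^sup>2) + ln (?s (k, t)))"
    by (subst sum.swap) (simp add: sum.cartesian_product)
  finally have eq: "residual_likelihood K snr inr C T w (output_record K snr inr C T w z) =
    exp (- (\<Sum>t<T. \<Sum>k<K. (?v (k, t))\<^sup>2 / (2 * (?s (k, t))\<^sup>2) + ln (?s (k, t))))" .
  have "(\<Sum>k<K. (?v (k, t))\<^sup>2 / (2 * (?s (k, t))\<^sup>2) + ln (?s (k, t))) \<le>
      (ln (1 + snr + inr) + ln (1 + snr / inr)) / 2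
     + 3 * real K / 2 * ((\<Sum>i<K. (?x i t)\<^sup>2) + (z (0, t))\<^sup>2)
     + (\<Sum>k<K. (z (k, t))\<^sup>2 + (z (0, t))\<^sup>2)" if t: "t < T" for t
  proof -
    let ?a = "3 * real K / 2 * ((\<Sum>i<K. (?x i t)\<^sup>2) + (z (0, t))\<^sup>2)"
    have split: "{..<K} = insert 0 (insert 1 ({..<K} - {0, 1}))" using K by auto
    have "(\<Sum>k<K. ln (?s (k, t))) = ln (?s (0, t)) + (ln (?s (1, t)) + (\<Sum>k\<in>{..<K} - {0, 1}. ln (?s (k, t))))"
      by (subst split) (simp add: insert_commute)
    \<comment> \<open>All further scales are 1, so two logarithms per channel use survive, whatever
      \<open>K\<close> is.\<close>
    also have "(\<Sum>k\<in>{..<K} - {0, 1}. ln (?s (k, t))) = 0"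
      by (intro sum.neutral) (auto simp: residual_scale_def)
    finally have logs: "(\<Sum>k<K. ln (?s (k, t))) = (ln (1 + snr + inr) + ln (1 + snr / inr)) / 2"
      using assms by (simp add: residual_scale_def ln_sqrt add_pos_nonneg add_divide_distrib)
    have "(?v (k, t))\<^sup>2 / (2 * (?s (k, t))\<^sup>2) \<le> (if k = 0 then ?a else 0) + ((z (k, t))\<^sup>2 + (z (0, t))\<^sup>2)"
      if k: "k < K" for k
    proof -
      consider "k = 0" | "k = 1" | "2 \<le> k" by linarith
      then show ?thesis
      proof cases
        case 1
        have "(?v (k, t))\<^sup>2 \<le> 3 * real K * (1 + snr + inr) * ((\<Sum>i<K. (?x i t)\<^sup>2) + (z (0, t))\<^sup>2)"
          using output_power_le[of K snr inr "\<lambda>i. ?x i t" "z (0, t)"] assms k t 1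
          by (simp add: residual_output_record output_record_eq)
        then have "(?v (k, t))\<^sup>2 / (2 * (?s (k, t))\<^sup>2) \<le> ?a"
          using assms 1 by (simp add: residual_scale_def divide_simps add_pos_nonneg) (simp add: algebra_simps)
        then show ?thesis using 1 by (simp add: add_increasing2)
      next
        case 2
        let ?c = "sqrt snr / sqrt inr"
        have c: "?c\<^sup>2 = snr / inr" using assms by (simp add: power_divide)
        \<comment> \<open>Dropping the second square leaves Cauchy-Schwarz, and the factor
          \<open>1 + c\<^sup>2\<close> is the squared scale of receiver \<open>1\<close>.\<close>
        have "(a - c * b)\<^sup>2 + (c * a + b)\<^sup>2 = (1 + c\<^sup>2) * (a\<^sup>2 + b\<^sup>2)" for a b c :: real
          by (simp add: power2_eq_square algebra_simps)
        from this[of "z (1, t)" ?c "z (0, t)"]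
        have "(z (1, t) - ?c * z (0, t))\<^sup>2 + (?c * z (1, t) + z (0, t))\<^sup>2
          = (1 + ?c\<^sup>2) * ((z (1, t))\<^sup>2 + (z (0, t))\<^sup>2)" .
        then have "(z (1, t) - ?c * z (0, t))\<^sup>2 \<le> (1 + snr / inr) * ((z (1, t))\<^sup>2 + (z (0, t))\<^sup>2)"
          unfolding c using zero_le_power2[of "?c * z (1, t) + z (0, t)"] by linarith
        then have "(z (1, t) - ?c * z (0, t))\<^sup>2 / (1 + snr / inr) \<le> (z (1, t))\<^sup>2 + (z (0, t))\<^sup>2"
          using assms by (subst pos_divide_le_eq) (auto simp: add_pos_nonneg mult.commute)
        moreover have half: "a / 2 \<le> b" if "a \<le> b" "0 \<le> b" for a b :: real
          using that by linarith
        ultimately have "(z (1, t) - ?c * z (0, t))\<^sup>2 / (1 + snr / inr) / 2 \<le> (z (1, t))\<^sup>2 + (z (0, t))\<^sup>2"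
          by (intro half) auto
        moreover have "(?v (k, t))\<^sup>2 / (2 * (?s (k, t))\<^sup>2) = (z (1, t) - ?c * z (0, t))\<^sup>2 / (1 + snr / inr) / 2"
          using 2 K t assms by (simp add: residual_output_record residual_scale_def add_nonneg_nonneg)
        ultimately have "(?v (k, t))\<^sup>2 / (2 * (?s (k, t))\<^sup>2) \<le> (z (1, t))\<^sup>2 + (z (0, t))\<^sup>2"
          by (simp only:)
        then show ?thesis using 2 by simp
      next
        case 3
        have "0 \<le> (z (k, t) + z (0, t))\<^sup>2" by simp
        then have "(z (k, t) - z (0, t))\<^sup>2 / 2 \<le> (z (k, t))\<^sup>2 + (z (0, t))\<^sup>2"
          by (simp add: power2_eq_square algebra_simps)
        then show ?thesis
          using 3 k K t assms by (simp add: residual_output_record residual_scale_def)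
      qed
    qed
    then have "(\<Sum>k<K. (?v (k, t))\<^sup>2 / (2 * (?s (k, t))\<^sup>2))
      \<le> (\<Sum>k<K. (if k = 0 then ?a else 0) + ((z (k, t))\<^sup>2 + (z (0, t))\<^sup>2))"
      by (intro sum_mono) auto
    also have "\<dots> = ?a + (\<Sum>k<K. (z (k, t))\<^sup>2 + (z (0, t))\<^sup>2)"
      using K by (subst sum.distrib) (simp add: sum.delta)
    finally show ?thesis
      unfolding sum.distrib[of _ "\<lambda>k. ln (?s (k, t))"] logs by linarith
  qed
  then show ?thesis
    unfolding eq cost_def by (auto intro!: sum_mono)
qed

lemma cost_nonneg:
  assumes "0 \<le> snr" "0 < inr"
  shows "0 \<le> cost K snr inr C T w z"
  unfolding cost_def using assms
  by (intro sum_nonneg add_nonneg_nonneg mult_nonneg_nonneg divide_nonneg_nonneg ln_ge_zero) auto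

section \<open>The converse bound\<close>

lemma sets_noise_law: "sets (noise_law K T) = sets (\<Pi>\<^sub>M i\<in>{..<K} \<times> {..<T}. borel)"
  by (intro sets_PiM_cong) auto

lemma prob_space_noise_law: "prob_space (noise_law K T)"
  by (intro prob_space_PiM prob_space_normal_density) simp

lemma prob_space_msg_noise: "prob_space (msg_noise K T C)"
proof -
  interpret N: prob_space "noise_law K T" by (rule prob_space_noise_law)
  interpret M: prob_space "msg_law K (msgs C)" by (rule prob_space_msg_law)
  interpret pair_prob_space "msg_law K (msgs C)" "noise_law K T" ..
  show ?thesis unfolding msg_noise_def by unfold_locales
qed

lemma nn_integral_msg_noise_snd:
  assumes "f \<in> borel_measurable (noise_law K T)"
  shows "(\<integral>\<^sup>+p. f (snd p) \<partial>msg_noise K T C) = (\<integral>\<^sup>+z. f z \<partial>noise_law K T)"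
proof -
  interpret N: prob_space "noise_law K T" by (rule prob_space_noise_law)
  interpret M: prob_space "msg_law K (msgs C)" by (rule prob_space_msg_law)
  show ?thesis
    unfolding msg_noise_def
    using N.nn_integral_fst[OF measurable_compose[OF measurable_snd assms], of "msg_law K (msgs C)", symmetric]
    by (simp add: M.emeasure_space_1)
qed

lemma noise_second_moment:
  assumes "k < K" "t < T"
  shows "has_bochner_integral (msg_noise K T C) (\<lambda>p. (snd p (k, t))\<^sup>2) 1"
proof (rule has_bochner_integral_nn_integral)
  have z: "(\<lambda>z. z (k, t)) \<in> noise_law K T \<rightarrow>\<^sub>M density lborel std_normal_density"
    using assms by (intro measurable_component_singleton) auto
  then have m: "(\<lambda>z. z (k, t)) \<in> borel_measurable (noise_law K T)" by simp
  from measurable_compose[OF measurable_snd this]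
  show "(\<lambda>p. (snd p (k, t))\<^sup>2) \<in> borel_measurable (msg_noise K T C)"
    unfolding msg_noise_def by (intro borel_measurable_power)
  have "(\<integral>\<^sup>+p. ennreal ((snd p (k, t))\<^sup>2) \<partial>msg_noise K T C) = (\<integral>\<^sup>+z. ennreal ((z (k, t))\<^sup>2) \<partial>noise_law K T)"
    using measurable_compose[OF borel_measurable_power[OF m] measurable_ennreal]
    by (rule nn_integral_msg_noise_snd)
  also have "\<dots> = (\<integral>\<^sup>+x. ennreal (x\<^sup>2) \<partial>distr (noise_law K T) (density lborel std_normal_density) (\<lambda>z. z (k, t)))"
    using z by (subst nn_integral_distr) auto
  also have "\<dots> = (\<integral>\<^sup>+x. ennreal (x\<^sup>2) \<partial>density lborel std_normal_density)"
    using assms by (subst distr_PiM_component) (auto intro!: prob_space_normal_density)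
  also have "\<dots> = (\<integral>\<^sup>+x. ennreal (std_normal_density x * x\<^sup>2) \<partial>lborel)"
    by (subst nn_integral_density) (auto simp: ennreal_mult')
  also have "\<dots> = 1"
    using std_normal_moment_even[of 1]
    by (subst nn_integral_eq_integral) (auto simp: has_bochner_integral_iff)
  finally show "(\<integral>\<^sup>+p. ennreal ((snd p (k, t))\<^sup>2) \<partial>msg_noise K T C) = ennreal 1" by simp
qed auto

lemma feedback_codeD:
  assumes "feedback_code K snr inr T C" "k < K"
  shows "0 < msgs C k" "dec C k \<in> (\<Pi>\<^sub>M s\<in>{..<T}. borel) \<rightarrow>\<^sub>M count_space UNIV"
    "t < T \<Longrightarrow> integrable (msg_noise K T C) (\<lambda>(w, z). (input K snr inr C w z k t)\<^sup>2)"
    "0 < T \<Longrightarrow> (\<Sum>t<T. \<integral>(w, z). (input K snr inr C w z k t)\<^sup>2 \<partial>msg_noise K T C) \<le> T"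
  using assms by (auto simp: feedback_code_def field_simps)

lemma feedback_code_measurable_encoders:
  "feedback_code K snr inr T C \<Longrightarrow> measurable_encoders K T C"
  by (auto simp: feedback_code_def measurable_encoders_def)

lemma error_event_measurable:
  assumes "measurable_encoders K T C" "k < K"
    and "dec C k \<in> (\<Pi>\<^sub>M s\<in>{..<T}. borel) \<rightarrow>\<^sub>M count_space UNIV"
  shows "{(w, z) \<in> space (msg_noise K T C). dec C k (outputs K snr inr C w z T k) \<noteq> w k} \<in> sets (msg_noise K T C)"
proof -
  have "Measurable.pred (noise_law K T) (\<lambda>z. dec C k (outputs K snr inr C w z T k) \<noteq> w k)" for w
  proof -
    have "(\<lambda>z. outputs K snr inr C w z T k) \<in> noise_law K T \<rightarrow>\<^sub>M (\<Pi>\<^sub>M s\<in>{..<T}. borel)"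
      unfolding measurable_cong_sets[OF sets_noise_law refl]
      using assms(1,2) by (intro measurable_outputs[where Z = "\<lambda>z. z"] measurable_component_singleton) auto
    from measurable_compose[OF this assms(3)]
    have [measurable]: "(\<lambda>z. dec C k (outputs K snr inr C w z T k)) \<in> noise_law K T \<rightarrow>\<^sub>M count_space UNIV" .
    show ?thesis by measurable
  qed
  from measurable_msg_law_pair[where f = "\<lambda>w z. dec C k (outputs K snr inr C w z T k) \<noteq> w k" and K = K and M = "msgs C", OF this]
  have "Measurable.pred (msg_noise K T C) (\<lambda>(w, z). dec C k (outputs K snr inr C w z T k) \<noteq> w k)"
    unfolding msg_noise_def by simp
  then have "{p \<in> space (msg_noise K T C). (\<lambda>(w, z). dec C k (outputs K snr inr C w z T k) \<noteq> w k) p} \<in> sets (msg_noise K T C)"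
    by (rule predE)
  then show ?thesis by (simp add: case_prod_beta')
qed

text \<open>The expected \<open>cost\<close> per channel use at full power:
  \<open>real K + 1\<close> collects the \<open>K\<close> input powers and the variance of
  \<open>z (0, t)\<close>, and \<open>2 * real K\<close> the pairs of noises.\<close>

definition cost_rate :: "nat \<Rightarrow> real \<Rightarrow> real \<Rightarrow> real" where
  "cost_rate K snr inr = (ln (1 + snr + inr) + ln (1 + snr / inr)) / 2 + 3 * real K / 2 * (real K + 1) + 2 * real K"

lemma expected_cost_le:
  assumes C: "feedback_code K snr inr T C" and K: "2 \<le> K" and T: "0 < T"
  shows "integrable (msg_noise K T C) (\<lambda>p. cost K snr inr C T (fst p) (snd p))"
    and "(\<integral>p. cost K snr inr C T (fst p) (snd p) \<partial>msg_noise K T C) \<le> T * cost_rate K snr inr"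
proof -
  interpret P: prob_space "msg_noise K T C" by (rule prob_space_msg_noise)
  let ?P = "msg_noise K T C"
  let ?e = "\<lambda>i t. \<integral>p. (input K snr inr C (fst p) (snd p) i t)\<^sup>2 \<partial>?P"
  let ?L = "(ln (1 + snr + inr) + ln (1 + snr / inr)) / 2"
  let ?a = "3 * real K / 2"
  have z: "has_bochner_integral ?P (\<lambda>p. (snd p (k, t))\<^sup>2) 1" if "k < K" "t < T" for k t
    using that by (rule noise_second_moment)
  have x: "has_bochner_integral ?P (\<lambda>p. (input K snr inr C (fst p) (snd p) i t)\<^sup>2) (?e i t)" if "i < K" "t < T" for i t
    using feedback_codeD(3)[OF C that] by (simp add: has_bochner_integral_iff case_prod_beta')
  have c: "has_bochner_integral ?P (\<lambda>p. c) c" for c :: real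
    by (simp add: has_bochner_integral_iff P.prob_space)
  have hb: "has_bochner_integral ?P (\<lambda>p. cost K snr inr C T (fst p) (snd p))
    (\<Sum>t<T. ?L + ?a * ((\<Sum>i<K. ?e i t) + 1) + (\<Sum>k<K. 1 + 1))"
    unfolding cost_def using K
    by (intro has_bochner_integral_sum has_bochner_integral_add has_bochner_integral_mult_right c x z) auto
  then show "integrable ?P (\<lambda>p. cost K snr inr C T (fst p) (snd p))"
    by (simp add: has_bochner_integral_iff)
  have "(\<Sum>i<K. \<Sum>t<T. ?e i t) \<le> (\<Sum>i<K. real T)"
    using feedback_codeD(4)[OF C _ T] by (intro sum_mono) (simp add: case_prod_beta')
  then have "(\<Sum>t<T. \<Sum>i<K. ?e i t) \<le> real K * real T"
    by (subst sum.swap) simp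
  then have "?a * (\<Sum>t<T. \<Sum>i<K. ?e i t) \<le> ?a * (real K * real T)"
    by (intro mult_left_mono) auto
  moreover have "(\<Sum>t<T. L + a * (E t + 1) + c) \<le> T * L + S + a * T + T * c"
    if "a * (\<Sum>t<T. E t) \<le> S" for L a c S :: real and E
    using that by (simp add: sum.distrib distrib_left sum_distrib_left)
  ultimately have "(\<Sum>t<T. ?L + ?a * ((\<Sum>i<K. ?e i t) + 1) + (\<Sum>k<K. 1 + 1))
      \<le> T * ?L + ?a * (real K * real T) + ?a * T + real T * (\<Sum>k<K. 1 + 1)"
    by blast
  also have "\<dots> = T * cost_rate K snr inr"
    by (simp add: cost_rate_def field_simps)
  finally show "(\<integral>p. cost K snr inr C T (fst p) (snd p) \<partial>?P) \<le> T * cost_rate K snr inr"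
    using hb by (simp add: has_bochner_integral_iff)
qed

text \<open>On correct decoding, the expectation of \<open>exp (- cost)\<close> is at most
  \<open>1 / (msgs C 0 * msgs C 1)\<close> by the change of measure. A Jensen-type lower bound for
  it in terms of the expected cost then limits the number of messages.\<close>

lemma message_count_le:
  assumes C: "feedback_code K snr inr T C" and K: "2 \<le> K" and T: "0 < T" and snr: "0 \<le> snr" "0 < inr"
    and e: "error_prob K snr inr T C 0 + error_prob K snr inr T C 1 \<le> e" "e < 1"
  shows "real (msgs C 0) * real (msgs C 1) * (1 - e) \<le> exp (T * cost_rate K snr inr / (1 - e))"
proof -
  interpret P: prob_space "msg_noise K T C" by (rule prob_space_msg_noise)
  let ?P = "msg_noise K T C"
  let ?J = "\<lambda>p. cost K snr inr C T (fst p) (snd p)"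
  let ?E = "\<lambda>k. {(w, z) \<in> space ?P. dec C k (outputs K snr inr C w z T k) \<noteq> w k}"
  note enc = feedback_code_measurable_encoders[OF C]
  have E: "?E k \<in> sets ?P" if "k < K" for k
    by (intro error_event_measurable enc that feedback_codeD(2)[OF C])
  define A where "A = space ?P - (?E 0 \<union> ?E 1)"
  have A [measurable]: "A \<in> sets ?P" unfolding A_def using E K by (intro sets.compl_sets sets.Un) auto
  have "P.prob (?E 0 \<union> ?E 1) \<le> e"
    using measure_Un_le[OF E[of 0] E[of 1]] e(1) K unfolding error_prob_def by linarith
  then have PA: "1 - e \<le> P.prob A"
    unfolding A_def using E K by (subst P.prob_compl) auto
  have J0: "0 \<le> ?J p" for p
    using cost_nonneg[OF snr] .
  note J [measurable] = expected_cost_le(1)[OF C K T]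
  have [measurable]: "?J \<in> borel_measurable ?P" using J by (rule borel_measurable_integrable)
  \<comment> \<open>An upper bound for the conditional mean of the cost given correct decoding; the
    exponential is bounded below by its tangent there.\<close>
  define a where "a = T * cost_rate K snr inr / (1 - e)"
  have "0 \<le> (\<integral>p. ?J p \<partial>?P)" by (intro Bochner_Integration.integral_nonneg J0)
  then have a0: "0 \<le> a"
    unfolding a_def using expected_cost_le(2)[OF C K T] e(2) by (intro divide_nonneg_nonneg) auto
  have mem: "decodes C T k (w k) (output_record K snr inr C T w z) \<longleftrightarrow> dec C k (outputs K snr inr C w z T k) = w k"
    if "k < K" for k w z
    unfolding decodes_def outputs_eq_output_record[OF that] ..
  have iA: "integrable ?P (\<lambda>p. exp (- ?J p) * indicator A p)"
    by (rule P.integrable_const_bound[where B = 1]) (use J0 in \<open>auto simp: indicator_def\<close>)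
  have iA': "integrable ?P (\<lambda>p. exp (- a) * ((1 + a) * indicator A p - ?J p))"
    using J by (intro integrable_mult_right Bochner_Integration.integrable_diff) (auto simp: P.emeasure_eq_measure)
  have "exp (- a) * (1 - e) \<le> exp (- a) * ((1 + a) * P.prob A - (\<integral>p. ?J p \<partial>?P))"
  proof (intro mult_left_mono)
    have "(1 + a) * (1 - e) \<le> (1 + a) * P.prob A"
      using PA a0 by (intro mult_left_mono) auto
    moreover have "a * (1 - e) = T * cost_rate K snr inr"
      using e(2) by (simp add: a_def)
    ultimately show "1 - e \<le> (1 + a) * P.prob A - (\<integral>p. ?J p \<partial>?P)"
      using expected_cost_le(2)[OF C K T] by (simp add: algebra_simps)
  qed simp
  also have "\<dots> = (\<integral>p. exp (- a) * ((1 + a) * indicator A p - ?J p) \<partial>?P)"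
    using J by (simp add: P.emeasure_eq_measure)
  also have "\<dots> \<le> (\<integral>p. exp (- ?J p) * indicator A p \<partial>?P)"
  proof (intro Bochner_Integration.integral_mono iA iA')
    fix p
    \<comment> \<open>The tangent bound serves on \<open>A\<close>. Off \<open>A\<close> the
      integrand on the left is nonpositive because the cost is nonnegative.\<close>
    have "exp (- a) * (1 + (a - ?J p)) \<le> exp (- a) * exp (a - ?J p)"
      by (intro mult_left_mono exp_ge_add_one_self) auto
    also have "\<dots> = exp (- ?J p)" by (simp flip: exp_add)
    finally show "exp (- a) * ((1 + a) * indicator A p - ?J p) \<le> exp (- ?J p) * indicator A p"
      using J0[of p] by (auto simp: indicator_def mult_le_0_iff algebra_simps)
  qed
  finally have "ennreal (exp (- a) * (1 - e)) \<le> ennreal (\<integral>p. exp (- ?J p) * indicator A p \<partial>?P)"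
    by (rule ennreal_leI)
  also have "\<dots> = (\<integral>\<^sup>+p. ennreal (exp (- ?J p) * indicator A p) \<partial>?P)"
    by (rule nn_integral_eq_integral[symmetric, OF iA]) auto
  also have "\<dots> \<le> (\<integral>\<^sup>+(w, z). ennreal (residual_likelihood K snr inr C T w (output_record K snr inr C T w z)) *
      (if decodes C T 0 (w 0) (output_record K snr inr C T w z) \<and> decodes C T 1 (w 1) (output_record K snr inr C T w z)
       then 1 else 0) \<partial>?P)"
    using residual_likelihood_ge[OF K snr] K
    by (intro nn_integral_mono) (auto simp: A_def indicator_def mem intro!: ennreal_leI)
  also have "\<dots> \<le> 1 / of_nat (msgs C 0) / of_nat (msgs C 1)"
    using K by (intro nn_integral_correct_residual_likelihood_le K snr enc feedback_codeD[OF C]) auto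
  also have "\<dots> = ennreal (1 / real (msgs C 0) / real (msgs C 1))"
    using feedback_codeD(1)[OF C, of 0] feedback_codeD(1)[OF C, of 1] K
    by (simp add: divide_ennreal ennreal_of_nat_eq_real_of_nat flip: ennreal_1)
  finally have "exp (- a) * (1 - e) \<le> 1 / real (msgs C 0) / real (msgs C 1)"
    by (simp add: ennreal_le_iff)
  then show ?thesis
    using feedback_codeD(1)[OF C, of 0] feedback_codeD(1)[OF C, of 1] K
    by (simp add: a_def[symmetric] exp_minus divide_simps mult_ac)
qed

text \<open>Logarithms of the previous bound, divided by \<open>T\<close>; as the errors vanish,
  both correction terms in \<open>e T\<close> disappear in the limit.\<close>

lemma achievable_imp_rate_le:
  assumes K: "2 \<le> K" and snr: "0 \<le> snr" "0 < inr" and R: "achievable K snr inr (\<lambda>k. R)"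
  shows "2 * R * ln 2 \<le> cost_rate K snr inr"
proof -
  let ?B = "cost_rate K snr inr"
  obtain C where C: "\<And>T. feedback_code K snr inr T (C T)"
    and M: "\<And>T k. k < K \<Longrightarrow> 2 powr (real T * R) \<le> real (msgs (C T) k)"
    and lim: "\<And>k. k < K \<Longrightarrow> (\<lambda>T. error_prob K snr inr T (C T) k) \<longlonglongrightarrow> 0"
    using R unfolding achievable_def by blast
  define e where "e T = error_prob K snr inr T (C T) 0 + error_prob K snr inr T (C T) 1" for T
  have e0: "e \<longlonglongrightarrow> 0"
    unfolding e_def using tendsto_add[OF lim[of 0] lim[of 1]] K by simp
  have bound: "2 * R * ln 2 + ln (1 - e T) / T \<le> ?B / (1 - e T)" if T: "0 < T" and e1: "e T < 1" for T
  proof -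
    have "2 powr (real T * R) * 2 powr (real T * R) * (1 - e T) \<le> real (msgs (C T) 0) * real (msgs (C T) 1) * (1 - e T)"
      using K e1 by (intro mult_right_mono mult_mono M) auto
    also have "\<dots> \<le> exp (T * ?B / (1 - e T))"
      by (rule message_count_le[OF C K T snr]) (use e1 in \<open>auto simp: e_def\<close>)
    finally have "2 powr (2 * (real T * R)) * (1 - e T) \<le> exp (T * ?B / (1 - e T))"
      by (simp only: mult_2[of "real T * R"] powr_add)
    then have "ln (2 powr (2 * (real T * R)) * (1 - e T)) \<le> T * ?B / (1 - e T)"
      using e1 by (subst (asm) ln_le_cancel_iff[symmetric]) auto
    then have "2 * (real T * R) * ln 2 + ln (1 - e T) \<le> T * ?B / (1 - e T)"
      using e1 by (simp add: ln_mult ln_powr)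
    then have "(2 * (real T * R) * ln 2 + ln (1 - e T)) / T \<le> (T * ?B / (1 - e T)) / T"
      using T by (intro divide_right_mono) auto
    then show ?thesis
      using T by (simp add: add_divide_distrib)
  qed
  have "eventually (\<lambda>T. e T < 1) sequentially"
    using order_tendstoD(2)[OF e0, of 1] by simp
  then have ev: "eventually (\<lambda>T. 2 * R * ln 2 + ln (1 - e T) / T \<le> ?B / (1 - e T)) sequentially"
    using eventually_gt_at_top[of 0] by eventually_elim (rule bound)
  have "(\<lambda>T. 2 * R * ln 2 + ln (1 - e T) * inverse (real T)) \<longlonglongrightarrow> 2 * R * ln 2 + ln (1 - 0) * 0"
    by (intro tendsto_intros e0 lim_inverse_n) auto
  moreover have "(\<lambda>T. ?B / (1 - e T)) \<longlonglongrightarrow> ?B / (1 - 0)"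
    by (intro tendsto_intros e0) auto
  ultimately show ?thesis
    using tendsto_le[OF _ _ _ ev[unfolded divide_inverse[of "ln _"]]] by force
qed

section \<open>Outer codes and large noises\<close>

text \<open>Choose the set of differing positions, in at most \<open>2 ^ n\<close> ways, and then
  the letters on it. The crude factor costs one bit per symbol, negligible for large
  alphabets.\<close>

lemma card_hamming_ball_le:
  assumes A: "finite A" "A \<noteq> {}"
  shows "card {y \<in> PiE {..<n} (\<lambda>_. A). card {s\<in>{..<n}. x s \<noteq> y s} \<le> d} \<le> 2 ^ n * card A ^ d"
proof -
  define F where "F J = {y \<in> PiE {..<n} (\<lambda>_. A). \<forall>s\<in>{..<n} - J. y s = x s}" for J
  have A1: "1 \<le> card A" using A by (simp add: Suc_le_eq card_gt_0_iff)
  have F: "card (F J) \<le> card A ^ d" if J: "J \<subseteq> {..<n}" "card J \<le> d" for J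
  proof -
    have "inj_on (\<lambda>y. restrict y J) (F J)"
    proof (rule inj_onI, rule ext)
      fix y y' s assume y: "y \<in> F J" "y' \<in> F J" and eq: "restrict y J = restrict y' J"
      consider "s \<in> J" | "s \<in> {..<n} - J" | "s \<notin> {..<n}" by blast
      then show "y s = y' s"
      proof cases
        case 1
        then show ?thesis using fun_cong[OF eq, of s] by simp
      next
        case 2
        then show ?thesis using y by (simp add: F_def)
      next
        case 3
        then show ?thesis using y by (auto simp: F_def PiE_def extensional_def)
      qed
    qed
    moreover have "(\<lambda>y. restrict y J) ` F J \<subseteq> PiE J (\<lambda>_. A)"
      using J by (auto simp: F_def)
    moreover have "finite (PiE J (\<lambda>_. A))"
      using J A finite_subset by (intro finite_PiE) auto
    ultimately have "card (F J) \<le> card (PiE J (\<lambda>_. A))"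
      by (intro card_inj_on_le)
    also have "\<dots> = card A ^ card J"
      using J finite_subset[OF J(1)] by (simp add: card_PiE)
    also have "\<dots> \<le> card A ^ d"
      using J A1 by (intro power_increasing) auto
    finally show ?thesis .
  qed
  have finF: "finite (F J)" for J
    unfolding F_def using A by (intro finite_subset[OF _ finite_PiE[of "{..<n}" "\<lambda>_. A"]]) auto
  let ?\<J> = "{J \<in> Pow {..<n}. card J \<le> d}"
  have "{y \<in> PiE {..<n} (\<lambda>_. A). card {s\<in>{..<n}. x s \<noteq> y s} \<le> d} \<subseteq> (\<Union>J\<in>?\<J>. F J)"
  proof
    fix y assume "y \<in> {y \<in> PiE {..<n} (\<lambda>_. A). card {s\<in>{..<n}. x s \<noteq> y s} \<le> d}"
    then have "y \<in> F {s\<in>{..<n}. x s \<noteq> y s}" "{s\<in>{..<n}. x s \<noteq> y s} \<in> ?\<J>"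
      by (auto simp: F_def)
    then show "y \<in> (\<Union>J\<in>?\<J>. F J)" by blast
  qed
  then have "card {y \<in> PiE {..<n} (\<lambda>_. A). card {s\<in>{..<n}. x s \<noteq> y s} \<le> d} \<le> card (\<Union>J\<in>?\<J>. F J)"
    by (intro card_mono) (auto intro!: finF)
  also have "\<dots> \<le> (\<Sum>J\<in>?\<J>. card (F J))"
    by (intro card_UN_le) auto
  also have "\<dots> \<le> (\<Sum>J\<in>?\<J>. card A ^ d)"
    by (intro sum_mono F) auto
  also have "\<dots> = card ?\<J> * card A ^ d" by simp
  also have "card ?\<J> \<le> card (Pow {..<n})" by (intro card_mono) auto
  also have "card (Pow {..<n}) = 2 ^ n" by (simp add: card_Pow)
  finally show ?thesis by simp
qed

text \<open>The balls of radius \<open>d\<close> around a maximal separated set cover the whole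
  space, since an uncovered word could be added.\<close>

lemma gilbert_varshamov:
  assumes A: "finite A" "A \<noteq> {}"
  obtains S where "S \<subseteq> PiE {..<n} (\<lambda>_. A)" "card A ^ n \<le> card S * (2 ^ n * card A ^ d)"
    "\<And>x y. x \<in> S \<Longrightarrow> y \<in> S \<Longrightarrow> x \<noteq> y \<Longrightarrow> d < card {s\<in>{..<n}. x s \<noteq> y s}"
proof -
  let ?W = "PiE {..<n} (\<lambda>_. A)"
  let ?ball = "\<lambda>x. {y \<in> ?W. card {s\<in>{..<n}. x s \<noteq> y s} \<le> d}"
  let ?sep = "\<lambda>S. \<forall>x\<in>S. \<forall>y\<in>S. x \<noteq> y \<longrightarrow> d < card {s\<in>{..<n}. x s \<noteq> y s}"
  have finW: "finite ?W" using A by (intro finite_PiE) auto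
  define \<F> where "\<F> = {S. S \<subseteq> ?W \<and> ?sep S}"
  have "finite \<F>"
    unfolding \<F>_def by (rule finite_subset[of _ "Pow ?W"]) (use finW in auto)
  moreover have "\<F> \<noteq> {}" by (auto simp: \<F>_def)
  ultimately obtain S where S_in: "S \<in> \<F>" and max: "\<forall>S'\<in>\<F>. S \<subseteq> S' \<longrightarrow> S = S'"
    using finite_has_maximal[of \<F>] by blast
  from S_in have S: "S \<subseteq> ?W" "?sep S" by (auto simp: \<F>_def)
  have "?W \<subseteq> (\<Union>x\<in>S. ?ball x)"
  proof
    fix y assume y: "y \<in> ?W"
    show "y \<in> (\<Union>x\<in>S. ?ball x)"
    proof (rule ccontr)
      assume "y \<notin> (\<Union>x\<in>S. ?ball x)"
      then have far: "d < card {s\<in>{..<n}. x s \<noteq> y s}" if "x \<in> S" for x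
        using that y by (auto simp: not_le)
      then have "d < card {s\<in>{..<n}. y s \<noteq> x s}" if "x \<in> S" for x
        using far[OF that] by (simp add: eq_commute)
      with far have "insert y S \<in> \<F>"
        using S y by (auto simp: \<F>_def)
      with max have "y \<in> S" by auto
      from far[OF this] show False by simp
    qed
  qed
  then have "card ?W \<le> card (\<Union>x\<in>S. ?ball x)"
    using S finW by (intro card_mono finite_UN_I) (auto intro: finite_subset)
  also have "\<dots> \<le> (\<Sum>x\<in>S. card (?ball x))"
    using S finW by (intro card_UN_le) (auto intro: finite_subset)
  also have "\<dots> \<le> (\<Sum>x\<in>S. 2 ^ n * card A ^ d)"
    by (intro sum_mono card_hamming_ball_le A)
  finally have "card A ^ n \<le> card S * (2 ^ n * card A ^ d)"
    by (simp add: card_PiE)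
  from that[OF S(1) this] S(2) show thesis by auto
qed

lemma codebook:
  assumes A: "finite A" "A \<noteq> {}"
  obtains cw :: "nat \<Rightarrow> nat \<Rightarrow> 'a" and M where "0 < M" "\<And>m s. cw m s \<in> A"
    "card A ^ n \<le> M * (2 ^ n * card A ^ d)"
    "\<And>m m'. m < M \<Longrightarrow> m' < M \<Longrightarrow> m \<noteq> m' \<Longrightarrow> d < card {s\<in>{..<n}. cw m s \<noteq> cw m' s}"
proof -
  obtain S where S: "S \<subseteq> PiE {..<n} (\<lambda>_. A)" "card A ^ n \<le> card S * (2 ^ n * card A ^ d)"
    and sep: "\<And>x y. x \<in> S \<Longrightarrow> y \<in> S \<Longrightarrow> x \<noteq> y \<Longrightarrow> d < card {s\<in>{..<n}. x s \<noteq> y s}"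
    by (rule gilbert_varshamov[OF A, of n d]) auto
  have "finite S"
    by (rule finite_subset[OF S(1)]) (use A in \<open>auto intro!: finite_PiE\<close>)
  then obtain f where f: "bij_betw f {..<card S} S"
    using ex_bij_betw_nat_finite[of S] by (auto simp: atLeast0LessThan)
  obtain a where a: "a \<in> A" using A by blast
  \<comment> \<open>Codewords are continued by a fixed letter to all positions and message numbers,
    as encoders must be defined there too.\<close>
  define cw where "cw m s = (if m < card S \<and> s < n then f m s else a)" for m s
  have fS: "f m \<in> S" if "m < card S" for m
    using f that by (auto simp: bij_betw_def)
  show thesis
  proof (rule that)
    have "0 < card A ^ n" using A by (simp add: card_gt_0_iff)
    with S(2) show "0 < card S" by (cases "card S") auto
    show "cw m s \<in> A" for m s
    proof (cases "m < card S \<and> s < n")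
      case True
      then have "f m \<in> PiE {..<n} (\<lambda>_. A)" using fS S(1) by blast
      then show ?thesis using True by (auto simp: cw_def)
    qed (use a in \<open>auto simp: cw_def\<close>)
    show "card A ^ n \<le> card S * (2 ^ n * card A ^ d)" by fact
    fix m m' assume m: "m < card S" "m' < card S" "m \<noteq> m'"
    then have "f m \<noteq> f m'" using f by (auto simp: bij_betw_def inj_on_def)
    then have "d < card {s\<in>{..<n}. f m s \<noteq> f m' s}" by (intro sep fS m)
    also have "{s\<in>{..<n}. f m s \<noteq> f m' s} = {s\<in>{..<n}. cw m s \<noteq> cw m' s}"
      using m by (auto simp: cw_def)
    finally show "d < card {s\<in>{..<n}. cw m s \<noteq> cw m' s}" .
  qed
qed

section \<open>Large noises are rare\<close>

abbreviation std_normal_law :: "real measure" where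
  "std_normal_law \<equiv> density lborel std_normal_density"

text \<open>Chebyshev's inequality; later \<open>c\<close> is chosen large enough to make the bound
  a small constant.\<close>

lemma std_normal_tail_le:
  assumes "0 < c"
  shows "measure std_normal_law {x. c < \<bar>x\<bar>} \<le> 1 / c\<^sup>2"
proof -
  interpret prob_space std_normal_law by (rule prob_space_normal_density) simp
  have "ennreal (measure std_normal_law {x. c < \<bar>x\<bar>}) = (\<integral>\<^sup>+x. indicator {x. c < \<bar>x\<bar>} x \<partial>std_normal_law)"
    by (simp add: emeasure_eq_measure)
  also have "\<dots> = (\<integral>\<^sup>+x. ennreal (std_normal_density x) * indicator {x. c < \<bar>x\<bar>} x \<partial>lborel)"
    by (subst nn_integral_density) auto
  also have "\<dots> \<le> (\<integral>\<^sup>+x. ennreal (1 / c\<^sup>2 * (std_normal_density x * x\<^sup>2)) \<partial>lborel)"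
  proof (rule nn_integral_mono)
    fix x :: real
    show "ennreal (std_normal_density x) * indicator {x. c < \<bar>x\<bar>} x \<le> ennreal (1 / c\<^sup>2 * (std_normal_density x * x\<^sup>2))"
    proof (cases "c < \<bar>x\<bar>")
      case True
      then have "c\<^sup>2 \<le> x\<^sup>2" using assms abs_le_square_iff[of c x] by simp
      then have "1 \<le> x\<^sup>2 / c\<^sup>2" using assms by simp
      from mult_left_mono[OF this, of "std_normal_density x"] True show ?thesis
        by (auto intro!: ennreal_leI simp: mult_ac)
    qed auto
  qed
  also have "\<dots> = ennreal (1 / c\<^sup>2)"
    using std_normal_moment_even[of 1]
    by (subst nn_integral_eq_integral) (auto simp: has_bochner_integral_iff)
  finally show ?thesis by simp
qed

lemma card_large_noises:
  assumes "finite I"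
  shows "real (card {i\<in>I. c < \<bar>z i\<bar>}) = (\<Sum>i\<in>I. if c < \<bar>z i\<bar> then 1 else 0 :: real)"
  using assms by (subst sum.If_cases) (auto simp: Int_def conj_commute)

lemma many_large_noises_measurable:
  assumes "finite I"
  shows "{z \<in> space (\<Pi>\<^sub>M i\<in>I. std_normal_law). a \<le> real (card {i\<in>I. c < \<bar>z i\<bar>})} \<in> sets (\<Pi>\<^sub>M i\<in>I. std_normal_law)"
proof -
  have [measurable]: "(\<lambda>z. z i) \<in> borel_measurable (\<Pi>\<^sub>M i\<in>I. std_normal_law)" if "i \<in> I" for i
    using measurable_component_singleton[OF that, of "\<lambda>_. std_normal_law"] by simp
  have [measurable]: "(\<lambda>z. \<Sum>i\<in>I. if c < \<bar>z i\<bar> then 1 else 0 :: real) \<in> borel_measurable (\<Pi>\<^sub>M i\<in>I. std_normal_law)"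
    by measurable
  show ?thesis unfolding card_large_noises[OF assms] by measurable
qed

text \<open>A Chernoff bound with exponent 1: the indicator of a large noise has exponential moment
  at most \<open>1 + 2 * p\<close>, because \<open>exp 1 \<le> 3\<close>, and this is at most
  \<open>exp (2 * p)\<close>.\<close>

lemma many_large_noises_le:
  fixes I :: "'i set"
  assumes I: "finite I" and p: "measure std_normal_law {x. c < \<bar>x\<bar>} \<le> p"
  shows "emeasure (\<Pi>\<^sub>M i\<in>I. std_normal_law) {z \<in> space (\<Pi>\<^sub>M i\<in>I. std_normal_law). a \<le> real (card {i\<in>I. c < \<bar>z i\<bar>})}
    \<le> ennreal (exp (2 * p * card I - a))"
proof -
  interpret prob_space std_normal_law by (rule prob_space_normal_density) simp
  interpret P: product_sigma_finite "\<lambda>_::'i. std_normal_law" ..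
  let ?P = "\<Pi>\<^sub>M i\<in>I. std_normal_law"
  let ?b = "\<lambda>x. if c < \<bar>x\<bar> then 1 else 0 :: real"
  let ?S = "{z \<in> space ?P. a \<le> real (card {i\<in>I. c < \<bar>z i\<bar>})}"
  note card = card_large_noises[OF I, of c]
  have zi [measurable]: "(\<lambda>z. z i) \<in> borel_measurable ?P" if "i \<in> I" for i
    using measurable_component_singleton[OF that, of "\<lambda>_. std_normal_law"] by simp
  have S: "?S \<in> sets ?P" by (rule many_large_noises_measurable[OF I])
  have "emeasure ?P ?S = (\<integral>\<^sup>+z. indicator ?S z \<partial>?P)"
    using S by simp
  also have "\<dots> \<le> (\<integral>\<^sup>+z. ennreal (exp (- a)) * (\<Prod>i\<in>I. ennreal (exp (?b (z i)))) \<partial>?P)"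
  proof (rule nn_integral_mono)
    fix z
    have "ennreal (exp (- a)) * (\<Prod>i\<in>I. ennreal (exp (?b (z i)))) = ennreal (exp ((\<Sum>i\<in>I. ?b (z i)) - a))"
      using I by (simp add: prod_ennreal exp_sum exp_diff exp_minus divide_inverse mult.commute flip: ennreal_mult')
    then show "indicator ?S z \<le> ennreal (exp (- a)) * (\<Prod>i\<in>I. ennreal (exp (?b (z i))))"
      by (auto simp: indicator_def card)
  qed
  also have "\<dots> = ennreal (exp (- a)) * (\<integral>\<^sup>+z. (\<Prod>i\<in>I. ennreal (exp (?b (z i)))) \<partial>?P)"
    by (rule nn_integral_cmult) measurable
  also have "(\<integral>\<^sup>+z. (\<Prod>i\<in>I. ennreal (exp (?b (z i)))) \<partial>?P) = (\<Prod>i\<in>I. \<integral>\<^sup>+x. ennreal (exp (?b x)) \<partial>std_normal_law)"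
    by (rule P.product_nn_integral_prod[OF I, where f = "\<lambda>_ x. ennreal (exp (?b x))"]) simp
  also have "\<dots> \<le> (\<Prod>i\<in>I. ennreal (exp (2 * p)))"
  proof (rule prod_mono_ennreal)
    have e: "exp 1 \<le> (3 :: real)" by (rule exp_le)
    have "(\<integral>\<^sup>+x. ennreal (exp (?b x)) \<partial>std_normal_law) \<le> (\<integral>\<^sup>+x. 1 + 2 * indicator {x. c < \<bar>x\<bar>} x \<partial>std_normal_law)"
      using ennreal_leI[OF e] by (intro nn_integral_mono) (auto simp: indicator_def)
    also have "\<dots> = 1 + 2 * emeasure std_normal_law {x. c < \<bar>x\<bar>}"
      by (subst nn_integral_add) (auto simp: emeasure_space_1[simplified] nn_integral_cmult)
    also have "\<dots> = ennreal (1 + 2 * measure std_normal_law {x. c < \<bar>x\<bar>})"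
      by (simp add: emeasure_eq_measure ennreal_mult)
    also have "\<dots> \<le> ennreal (exp (2 * p))"
    proof (rule ennreal_leI)
      have "1 + 2 * p \<le> exp (2 * p)" by (rule exp_ge_add_one_self)
      then show "1 + 2 * measure std_normal_law {x. c < \<bar>x\<bar>} \<le> exp (2 * p)" using p by linarith
    qed
    finally show "(\<integral>\<^sup>+x. ennreal (exp (?b x)) \<partial>std_normal_law) \<le> ennreal (exp (2 * p))" .
  qed
  also have "(\<Prod>i\<in>I. ennreal (exp (2 * p))) = ennreal (exp (2 * p * card I))"
    by (simp add: ennreal_power flip: exp_of_nat_mult)
  also have "ennreal (exp (- a)) * ennreal (exp (2 * p * card I)) = ennreal (exp (2 * p * card I - a))"
    by (simp add: exp_diff exp_minus divide_inverse mult.commute flip: ennreal_mult')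
  finally show ?thesis by (simp add: mult_left_mono)
qed

section \<open>The forwarding scheme\<close>

text \<open>The coarse step \<open>p\<close> exceeds the noise plus the whole range \<open>E\<close>
  of the fine level, and the fine step \<open>q\<close> exceeds the noise alone. The noise enters as
  \<open>2 * r\<close> because two explanations of one output are compared.\<close>

lemma two_level_unique:
  fixes p q r E :: real and s s' b b' :: nat
  assumes "\<bar>p * (real s - real s') + q * (real b - real b')\<bar> \<le> 2 * r" "\<bar>q * (real b - real b')\<bar> \<le> E"
    and "2 * r + E < \<bar>p\<bar>" "2 * r < q" "0 \<le> r"
  shows "s = s' \<and> b = b'"
proof -
  have one: "1 \<le> \<bar>real m - real m'\<bar>" if "m \<noteq> m'" for m m' :: nat
    using that by linarith
  have s: "s = s'"
  proof (rule ccontr)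
    assume "s \<noteq> s'"
    then have "\<bar>p\<bar> * 1 \<le> \<bar>p\<bar> * \<bar>real s - real s'\<bar>" by (intro mult_left_mono one) auto
    then have "\<bar>p\<bar> \<le> \<bar>p * (real s - real s')\<bar>" by (simp add: abs_mult)
    with assms show False by linarith
  qed
  moreover have "b = b'"
  proof (rule ccontr)
    assume "b \<noteq> b'"
    then have "\<bar>q\<bar> * 1 \<le> \<bar>q\<bar> * \<bar>real b - real b'\<bar>" by (intro mult_left_mono one) auto
    then have "\<bar>q\<bar> \<le> \<bar>q * (real b - real b')\<bar>" by (simp add: abs_mult)
    with assms(1,4) s show False by simp
  qed
  ultimately show ?thesis ..
qed

text \<open>
  A symbol \<open>(a, b, b')\<close> occupies two channel uses. User \<open>k\<close> first sends \<open>A a + B b\<close>; its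
  receiver's output then reveals the sum of the other users' \<open>a\<close>'s, and user \<open>k\<close> next sends a
  multiple of the sum \<open>S\<close> of all the \<open>a\<close>'s, superposed with the fresh digit \<open>b'\<close>. The signals
  weighted by \<open>B\<close> reach the other receivers at noise level.
\<close>

locale interference_forwarding =
  fixes K :: nat and snr inr c :: real
  assumes K: "2 \<le> K" and snr: "0 < snr" and inr: "1 \<le> inr" and c: "0 < c"
    and gap: "max (sqrt snr) (sqrt inr) \<le> 2 * \<bar>sqrt snr - sqrt inr\<bar>"
begin

abbreviation g :: real where "g \<equiv> sqrt snr"
abbreviation h :: real where "h \<equiv> sqrt inr"

text \<open>Bounds a noise of size \<open>c\<close> together with the private signals of the other
  users, each at most \<open>1 / 2\<close> on arrival.\<close>

definition r :: real where "r = real K + c"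
text \<open>The factor \<open>real K\<close> makes up for the amplitude \<open>A / K\<close> used in
  the second channel use.\<close>

definition common_spacing :: real where "common_spacing = real K * (4 * r + 2)"
definition private_spacing :: real where "private_spacing = 2 * r + 1"
text \<open>\<open>A\<close> fixes the spacing of the common integers at the unintended receivers,
  and \<open>B\<close> that of the private digits at the intended one.\<close>

definition A :: real where "A = common_spacing / h"
definition B :: real where "B = private_spacing / g"
text \<open>\<open>Na\<close> keeps the common part of an input below \<open>1 / 2\<close>;
  \<open>Nb\<close> keeps a private signal below \<open>1 / 2\<close> at the unintended receivers.
  When \<open>h\<close> is large compared with \<open>g\<close>, \<open>Nb\<close> is
  \<open>0\<close> and only common integers are sent.\<close>

definition Na :: nat where "Na = nat \<lfloor>h / (2 * common_spacing)\<rfloor>"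
definition Nb :: nat where "Nb = nat \<lfloor>g / (2 * h * private_spacing)\<rfloor>"

lemma pos: "0 < g" "1 \<le> h" "0 < r" "0 < common_spacing" "0 < private_spacing" "0 < A" "0 < B"
  using K snr inr c
  by (auto simp: r_def common_spacing_def private_spacing_def A_def B_def
      intro!: mult_pos_pos divide_pos_pos add_pos_pos)

lemma hA: "h * A = common_spacing" and gB: "g * B = private_spacing"
  using pos by (auto simp: A_def B_def)

lemma A_bound: "a \<le> Na \<Longrightarrow> A * real a \<le> 1 / 2"
proof -
  assume "a \<le> Na"
  then have "real a \<le> h / (2 * common_spacing)"
    using pos unfolding Na_def by (simp add: le_nat_floor le_floor_iff nat_le_iff le_nat_iff)
  then have "A * real a \<le> A * (h / (2 * common_spacing))" using pos by (intro mult_left_mono) auto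
  also have "\<dots> = 1 / 2" using pos by (simp add: A_def)
  finally show ?thesis .
qed

lemma B_bound: "b \<le> Nb \<Longrightarrow> h * (B * real b) \<le> 1 / 2"
proof -
  assume "b \<le> Nb"
  then have "real b \<le> g / (2 * h * private_spacing)"
    using pos unfolding Nb_def by (simp add: le_nat_floor le_floor_iff nat_le_iff le_nat_iff)
  then have "h * (B * real b) \<le> h * (B * (g / (2 * h * private_spacing)))"
    using pos by (intro mult_left_mono) auto
  also have "\<dots> = 1 / 2" using pos by (simp add: B_def)
  finally show ?thesis .
qed

lemma B_bound': "b \<le> Nb \<Longrightarrow> B * real b \<le> 1 / 2"
proof -
  assume "b \<le> Nb"
  moreover have "1 * (B * real b) \<le> h * (B * real b)"
    using pos by (intro mult_right_mono) auto
  ultimately show ?thesis using B_bound[of b] by linarith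
qed

lemma private_diff_bound:
  assumes "b \<le> Nb" "b' \<le> Nb"
  shows "\<bar>private_spacing * (real b - real b')\<bar> \<le> g / (2 * h)"
proof -
  have *: "private_spacing * real m \<le> g / (2 * h)" "0 \<le> private_spacing * real m" if "m \<le> Nb" for m
  proof -
    have "g / h * (h * (B * real m)) \<le> g / h * (1 / 2)"
      using B_bound[OF that] pos by (intro mult_left_mono) auto
    then show "private_spacing * real m \<le> g / (2 * h)"
      using pos by (simp add: B_def)
  qed (use pos in auto)
  from *[OF assms(1)] *[OF assms(2)] show ?thesis
    by (simp add: right_diff_distrib abs_le_iff)
qed

text \<open>As \<open>max g h / h\<close> is at least \<open>1\<close> and at least
  \<open>g / h\<close>, its multiple by \<open>4 * r\<close> pays for the noise and its multiple by
  \<open>2\<close> for the range of the private digits.\<close>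

lemma dominant_gain:
  assumes "max g h / h * (4 * r + 2) \<le> q"
  shows "2 * r + g / (2 * h) < q"
proof -
  have m: "1 \<le> max g h / h" "g / h \<le> max g h / h"
    using pos by (auto simp: divide_simps)
  have "1 * (4 * r) \<le> max g h / h * (4 * r)"
    using m pos by (intro mult_right_mono) auto
  then have "4 * r + 2 * (max g h / h) \<le> q" using assms by (simp add: algebra_simps)
  moreover have "g / (2 * h) = g / h / 2" by simp
  ultimately show ?thesis using m pos by linarith
qed

text \<open>The gain of a user's own integer once \<open>S\<close> is known. The factor 2 lost in
  \<open>gap\<close> is recovered from \<open>2 \<le> K\<close> in
  \<open>common_spacing\<close>.\<close>

lemma first_gain: "2 * r + g / (2 * h) < \<bar>(g - h) * A\<bar>"
proof (rule dominant_gain)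
  have "m / h * x = m / 2 * (2 * x / h)" for m x :: real by simp
  then have "max g h / h * (4 * r + 2) = max g h / 2 * (2 * (4 * r + 2) / h)" .
  also have "\<dots> \<le> \<bar>g - h\<bar> * A"
    using gap K pos unfolding A_def common_spacing_def
    by (intro mult_mono divide_right_mono mult_right_mono) auto
  finally show "max g h / h * (4 * r + 2) \<le> \<bar>(g - h) * A\<bar>"
    using pos by (simp add: abs_mult)
qed

text \<open>The gain of \<open>S\<close> in the second channel use, where the contributions of all
  users add up coherently.\<close>

lemma second_gain: "2 * r + g / (2 * h) < \<bar>(g + (real K - 1) * h) * (A / real K)\<bar>"
proof (rule dominant_gain)
  have "1 * h \<le> (real K - 1) * h"
    using K pos by (intro mult_right_mono) auto
  then have m: "max g h \<le> g + (real K - 1) * h" using pos by linarith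
  have "max g h / h * (4 * r + 2) = max g h * (A / real K)"
    using K by (simp add: A_def common_spacing_def)
  also have "\<dots> \<le> (g + (real K - 1) * h) * (A / real K)"
    using m pos by (intro mult_right_mono) auto
  finally show "max g h / h * (4 * r + 2) \<le> \<bar>(g + (real K - 1) * h) * (A / real K)\<bar>" by linarith
qed

lemma private_interference_bound:
  assumes "\<And>i. i < K \<Longrightarrow> b i \<le> Nb" "\<bar>z\<bar> \<le> c"
  shows "\<bar>h * (\<Sum>i\<in>{..<K} - {k}. B * real (b i)) + z\<bar> \<le> r"
proof -
  have "h * (\<Sum>i\<in>{..<K} - {k}. B * real (b i)) \<le> (\<Sum>i\<in>{..<K} - {k}. 1 / 2)"
    unfolding sum_distrib_left using assms(1) B_bound by (intro sum_mono) auto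
  also have "\<dots> \<le> (\<Sum>i\<in>{..<K}. 1)"
    by (rule order_trans[OF sum_mono2[of "{..<K}"]]) (auto intro: sum_mono)
  finally have "h * (\<Sum>i\<in>{..<K} - {k}. B * real (b i)) \<le> real K" by simp
  moreover have "0 \<le> h * (\<Sum>i\<in>{..<K} - {k}. B * real (b i))"
    using pos by (intro mult_nonneg_nonneg sum_nonneg) auto
  ultimately show ?thesis using assms(2) c by (simp add: r_def)
qed

text \<open>Rounds \<open>v / common_spacing\<close> and clips the result to the possible sums of
  \<open>K - 1\<close> integers. As a sum of threshold functions it is visibly measurable, and the
  clipping bounds the inputs for every noise realization.\<close>

definition forwarded :: "real \<Rightarrow> real" where
  "forwarded v = (\<Sum>j<(K - 1) * Na. if (real j + 1 / 2) * common_spacing \<le> v then 1 else 0)"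

lemma forwarded_bounds: "0 \<le> forwarded v" "forwarded v \<le> real ((K - 1) * Na)"
proof -
  show "0 \<le> forwarded v" unfolding forwarded_def by (intro sum_nonneg) auto
  have "forwarded v \<le> (\<Sum>j<(K - 1) * Na. 1)"
    unfolding forwarded_def by (intro sum_mono) auto
  then show "forwarded v \<le> real ((K - 1) * Na)" by simp
qed

lemma forwarded_eq:
  assumes "n \<le> (K - 1) * Na" "\<bar>v - common_spacing * real n\<bar> \<le> r"
  shows "forwarded v = real n"
proof -
  have "1 * (4 * r + 2) \<le> common_spacing"
    unfolding common_spacing_def using K pos by (intro mult_right_mono) auto
  then have v: "common_spacing * (real n - 1 / 2) < v" "v < common_spacing * (real n + 1 / 2)"
    using assms(2) pos by (auto simp: algebra_simps abs_le_iff)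
  have "(real j + 1 / 2) * common_spacing \<le> v \<longleftrightarrow> j < n" for j
  proof (cases "j < n")
    case True
    then have "(real j + 1 / 2) * common_spacing \<le> (real n - 1 / 2) * common_spacing"
      using pos by (intro mult_right_mono) auto
    with v True show ?thesis by (simp add: mult.commute)
  next
    case False
    then have "(real n + 1 / 2) * common_spacing \<le> (real j + 1 / 2) * common_spacing"
      using pos by (intro mult_right_mono) auto
    with v False show ?thesis by (simp add: mult.commute)
  qed
  then have "forwarded v = (\<Sum>j<(K - 1) * Na. if j < n then 1 else 0)"
    unfolding forwarded_def by simp
  also have "\<dots> = real (card ({..<(K - 1) * Na} \<inter> {j. j < n}))"
    by (subst sum.If_cases) auto
  also have "{..<(K - 1) * Na} \<inter> {j. j < n} = {..<n}" using assms(1) by auto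
  finally show ?thesis by simp
qed

definition first_input :: "nat \<times> nat \<times> nat \<Rightarrow> real" where
  "first_input = (\<lambda>(a, b, b'). A * real a + B * real b)"

text \<open>The user's own signal is subtracted from the feedback before rounding. Dividing by
  \<open>K\<close> is possible within the power because the sum is at most
  \<open>K * Na\<close>.\<close>

definition second_input :: "nat \<times> nat \<times> nat \<Rightarrow> real \<Rightarrow> real" where
  "second_input = (\<lambda>(a, b, b') y.
     A / real K * (real a + forwarded (y - g * first_input (a, b, b'))) + B * real b')"

definition symbols :: "(nat \<times> nat \<times> nat) set" where
  "symbols = {..Na} \<times> {..Nb} \<times> {..Nb}"

text \<open>The test made by the receiver. Writing the other users' sum as \<open>S - a\<close>
  turns the gain of \<open>a\<close> in the first output into \<open>g - h\<close>. The sum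
  \<open>S\<close> is unknown to the receiver, hence quantified.\<close>

definition consistent :: "nat \<times> nat \<times> nat \<Rightarrow> real \<Rightarrow> real \<Rightarrow> bool" where
  "consistent = (\<lambda>(a, b, b') y y'. \<exists>S.
     \<bar>y' - (g + (real K - 1) * h) * (A / real K) * real S - private_spacing * real b'\<bar> \<le> r \<and>
     \<bar>y - (g - h) * A * real a - common_spacing * real S - private_spacing * real b\<bar> \<le> r)"

lemma first_input_bounded: "\<tau> \<in> symbols \<Longrightarrow> \<bar>first_input \<tau>\<bar> \<le> 1"
proof -
  assume "\<tau> \<in> symbols"
  then obtain a b b' where \<tau>: "\<tau> = (a, b, b')" "a \<le> Na" "b \<le> Nb" by (auto simp: symbols_def)
  have "0 \<le> A * real a" "0 \<le> B * real b" using pos by auto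
  then show ?thesis using A_bound[OF \<tau>(2)] B_bound'[OF \<tau>(3)] by (simp add: first_input_def \<tau>(1))
qed

lemma second_input_bounded: "\<tau> \<in> symbols \<Longrightarrow> \<bar>second_input \<tau> y\<bar> \<le> 1"
proof -
  assume "\<tau> \<in> symbols"
  then obtain a b b' where \<tau>: "\<tau> = (a, b, b')" "a \<le> Na" "b' \<le> Nb" by (auto simp: symbols_def)
  let ?f = "forwarded (y - g * first_input (a, b, b'))"
  have "real a + ?f \<le> real Na + real ((K - 1) * Na)"
    using \<tau> forwarded_bounds by (intro add_mono) auto
  also have "\<dots> = real K * real Na"
    using K by (simp add: of_nat_diff algebra_simps)
  finally have "A / real K * (real a + ?f) \<le> A / real K * (real K * real Na)"
    using pos by (intro mult_left_mono) auto
  also have "\<dots> = A * real Na" using K by simp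
  finally have "A / real K * (real a + ?f) \<le> 1 / 2" using A_bound[OF order_refl] by (rule order_trans)
  moreover have "0 \<le> A / real K * (real a + ?f)" "0 \<le> B * real b'"
    using pos forwarded_bounds by auto
  ultimately have "\<bar>A / real K * (real a + ?f) + B * real b'\<bar> \<le> 1"
    using B_bound'[OF \<tau>(3)] by linarith
  then show ?thesis by (simp only: second_input_def \<tau>(1) prod.case)
qed

text \<open>The second output determines \<open>S\<close> and the second digit; with
  \<open>S\<close> known, the first output determines the integer and the first digit.\<close>

lemma consistent_unique:
  assumes "\<tau> \<in> symbols" "\<tau>' \<in> symbols" "consistent \<tau> y y'" "consistent \<tau>' y y'"
  shows "\<tau> = \<tau>'"
proof -
  obtain a1 b1 c1 where 1: "\<tau> = (a1, b1, c1)" "b1 \<le> Nb" "c1 \<le> Nb" using assms(1) by (auto simp: symbols_def)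
  obtain a2 b2 c2 where 2: "\<tau>' = (a2, b2, c2)" "b2 \<le> Nb" "c2 \<le> Nb" using assms(2) by (auto simp: symbols_def)
  let ?D = "(g + (real K - 1) * h) * (A / real K)"
  obtain S1 where S1: "\<bar>y' - ?D * real S1 - private_spacing * real c1\<bar> \<le> r"
     "\<bar>y - (g - h) * A * real a1 - common_spacing * real S1 - private_spacing * real b1\<bar> \<le> r"
    using assms(3) unfolding consistent_def 1 by auto
  obtain S2 where S2: "\<bar>y' - ?D * real S2 - private_spacing * real c2\<bar> \<le> r"
     "\<bar>y - (g - h) * A * real a2 - common_spacing * real S2 - private_spacing * real b2\<bar> \<le> r"
    using assms(4) unfolding consistent_def 2 by auto
  have q: "2 * r < private_spacing" by (simp add: private_spacing_def)
  have "S1 = S2 \<and> c1 = c2"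
  proof (rule two_level_unique[OF _ private_diff_bound[OF 1(3) 2(3)] second_gain q])
    show "\<bar>?D * (real S1 - real S2) + private_spacing * (real c1 - real c2)\<bar> \<le> 2 * r"
      using S1(1) S2(1) unfolding right_diff_distrib abs_le_iff by linarith
  qed (use pos in auto)
  moreover from this have SS: "S2 = S1" by simp
  have "a1 = a2 \<and> b1 = b2"
  proof (rule two_level_unique[OF _ private_diff_bound[OF 1(2) 2(2)] first_gain q])
    show "\<bar>(g - h) * A * (real a1 - real a2) + private_spacing * (real b1 - real b2)\<bar> \<le> 2 * r"
      using S1(2) S2(2)[unfolded SS] unfolding right_diff_distrib[of "(g - h) * A"] right_diff_distrib[of private_spacing] abs_le_iff by linarith
  qed (use pos in auto)
  ultimately show ?thesis using 1 2 by simp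
qed

text \<open>The noises at all receivers have to be small, since every user must forward the correct
  sum.\<close>

lemma consistent_of_small_noise:
  assumes \<tau>: "\<And>i. i < K \<Longrightarrow> \<tau> i \<in> symbols"
    and z: "\<And>i. i < K \<Longrightarrow> \<bar>z i\<bar> \<le> c" "\<And>i. i < K \<Longrightarrow> \<bar>z' i\<bar> \<le> c"
    and y: "\<And>i. i < K \<Longrightarrow> y i = channel_output K snr inr (\<lambda>j. first_input (\<tau> j)) z i"
    and y': "\<And>i. i < K \<Longrightarrow> y' i = channel_output K snr inr (\<lambda>j. second_input (\<tau> j) (y j)) z' i"
    and k: "k < K"
  shows "consistent (\<tau> k) (y k) (y' k)"
proof -
  define a b b' where "a i = fst (\<tau> i)" and "b i = fst (snd (\<tau> i))" and "b' i = snd (snd (\<tau> i))" for i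
  have \<tau>_eq: "\<tau> i = (a i, b i, b' i)" for i by (simp add: a_def b_def b'_def)
  have bounds: "a i \<le> Na" "b i \<le> Nb" "b' i \<le> Nb" if "i < K" for i
    using \<tau>[OF that] by (auto simp: symbols_def \<tau>_eq)
  let ?S = "\<Sum>i<K. a i"
  let ?o = "\<lambda>k. \<Sum>i\<in>{..<K} - {k}. a i"
  have S: "?S = a i + ?o i" if "i < K" for i
    using that by (intro sum.remove) auto
  have first: "\<bar>y i - g * first_input (\<tau> i) - common_spacing * real (?o i)\<bar> \<le> r" if i: "i < K" for i
  proof -
    have "y i - g * first_input (\<tau> i) - common_spacing * real (?o i)
      = h * (\<Sum>j\<in>{..<K} - {i}. B * real (b j)) + z i"
      by (simp add: y[OF i] channel_output_def first_input_def \<tau>_eq sum_distrib_left sum.distrib distrib_left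
          flip: hA) (simp add: mult_ac)
    then show ?thesis using private_interference_bound[of b "z i" i] bounds z(1)[OF i] by simp
  qed
  have "forwarded (y i - g * first_input (\<tau> i)) = real (?o i)" if i: "i < K" for i
  proof (rule forwarded_eq[OF _ first[OF i]])
    have "?o i \<le> (\<Sum>j\<in>{..<K} - {i}. Na)" by (intro sum_mono bounds) auto
    also have "\<dots> = (K - 1) * Na" using i by simp
    finally show "?o i \<le> (K - 1) * Na" .
  qed
  \<comment> \<open>All users now send the same common part.\<close>
  then have second: "second_input (\<tau> i) (y i) = A / real K * real ?S + B * real (b' i)" if i: "i < K" for i
    using S[OF i] i by (simp add: second_input_def \<tau>_eq)
  have "y' k = g * second_input (\<tau> k) (y k) + (\<Sum>i\<in>{..<K} - {k}. h * second_input (\<tau> i) (y i)) + z' k"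
    using y'[OF k] by (simp add: channel_output_def)
  also have "(\<Sum>i\<in>{..<K} - {k}. h * second_input (\<tau> i) (y i))
      = (\<Sum>i\<in>{..<K} - {k}. h * (A / real K * real ?S) + h * (B * real (b' i)))"
    by (intro sum.cong refl) (auto simp: second distrib_left)
  also have "\<dots> = (real K - 1) * (h * (A / real K * real ?S)) + h * (\<Sum>i\<in>{..<K} - {k}. B * real (b' i))"
    using k by (simp add: sum.distrib of_nat_diff sum_distrib_left)
  finally have "y' k - (g + (real K - 1) * h) * (A / real K) * real ?S - private_spacing * real (b' k)
    = h * (\<Sum>i\<in>{..<K} - {k}. B * real (b' i)) + z' k"
  proof -
    assume eq: "y' k = g * second_input (\<tau> k) (y k)
      + ((real K - 1) * (h * (A / real K * real ?S)) + h * (\<Sum>i\<in>{..<K} - {k}. B * real (b' i))) + z' k"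
    have "g * (X + B * d) + ((real K - 1) * (h * X) + P) + u - (g + (real K - 1) * h) * X - private_spacing * d = P + u"
      for X d P u by (simp add: algebra_simps flip: gB)
    then show ?thesis unfolding eq second[OF k] mult.assoc[of _ "A / real K"] .
  qed
  then have "\<bar>y' k - (g + (real K - 1) * h) * (A / real K) * real ?S - private_spacing * real (b' k)\<bar> \<le> r"
    using private_interference_bound[of b' "z' k" k] bounds z(2)[OF k] by simp
  moreover have "y k - (g - h) * A * real (a k) - common_spacing * real ?S - private_spacing * real (b k)
    = y k - g * first_input (\<tau> k) - common_spacing * real (?o k)"
    using S[OF k] by (simp add: first_input_def \<tau>_eq algebra_simps flip: gB hA)
  ultimately show ?thesis
    unfolding consistent_def \<tau>_eq[of k] using first[OF k] by (auto intro!: exI[of _ ?S] simp: \<tau>_eq)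
qed

end

section \<open>The block code and its error probability\<close>

lemma nn_integral_msg_noise_fst:
  "(\<integral>\<^sup>+p. f (fst p) \<partial>msg_noise K T C) = (\<integral>\<^sup>+w. f w \<partial>msg_law K (msgs C))"
proof -
  interpret N: prob_space "noise_law K T" by (rule prob_space_noise_law)
  have "(\<lambda>p. f (fst p)) \<in> borel_measurable (msg_law K (msgs C) \<Otimes>\<^sub>M noise_law K T)"
    by (rule measurable_compose[OF measurable_fst measurable_msg_law])
  from N.nn_integral_fst[OF this, symmetric] show ?thesis
    by (simp add: msg_noise_def N.emeasure_space_1)
qed

context interference_forwarding
begin

definition mismatches :: "(nat \<Rightarrow> nat \<Rightarrow> nat \<times> nat \<times> nat) \<Rightarrow> nat \<Rightarrow> nat \<Rightarrow> (nat \<Rightarrow> real) \<Rightarrow> real" where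
  "mismatches cw n m y = (\<Sum>s<n. if consistent (cw m s) (y (2 * s)) (y (2 * s + 1)) then 0 else 1)"

text \<open>The decoder takes the first message with at most \<open>e\<close> inconsistent symbols
  instead of the closest one. Channel uses from \<open>2 * n\<close> on are ignored.\<close>

definition forwarding_code :: "(nat \<Rightarrow> nat \<Rightarrow> nat \<times> nat \<times> nat) \<Rightarrow> nat \<Rightarrow> nat \<Rightarrow> nat \<Rightarrow> code" where
  "forwarding_code cw M n e =
     \<lparr>msgs = (\<lambda>k. M),
      enc = (\<lambda>k t m y. if even t then first_input (cw m (t div 2)) else second_input (cw m (t div 2)) (y (t - 1))),
      dec = (\<lambda>k y. LEAST m. m < M \<and> mismatches cw n m y \<le> real e)\<rparr>"

lemma mismatches_eq_card:
  "mismatches cw n m y = real (card {s\<in>{..<n}. \<not> consistent (cw m s) (y (2 * s)) (y (2 * s + 1))})"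
  unfolding mismatches_def by (subst sum.If_cases) (auto simp: Int_def conj_commute)

lemma measurable_second_input [measurable]: "second_input \<tau> \<in> borel_measurable borel"
  unfolding second_input_def forwarded_def by (cases \<tau>) simp

lemma measurable_consistent:
  assumes [measurable]: "f \<in> borel_measurable N" "f' \<in> borel_measurable N"
  shows "Measurable.pred N (\<lambda>x. consistent \<tau> (f x) (f' x))"
  unfolding consistent_def by (cases \<tau>) simp

lemma measurable_forwarding_decoder:
  assumes "2 * n \<le> T"
  shows "dec (forwarding_code cw M n e) k \<in> (\<Pi>\<^sub>M s\<in>{..<T}. borel) \<rightarrow>\<^sub>M count_space UNIV"
proof -
  have comp: "(\<lambda>y. y s) \<in> borel_measurable (\<Pi>\<^sub>M s\<in>{..<T}. (borel :: real measure))" if "s < T" for s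
    using that by (intro measurable_component_singleton) auto
  have "(\<lambda>y. mismatches cw n m y) \<in> borel_measurable (\<Pi>\<^sub>M s\<in>{..<T}. borel)" for m
    unfolding mismatches_def
  proof (rule borel_measurable_sum)
    fix s assume "s \<in> {..<n}"
    then have [measurable]: "Measurable.pred (\<Pi>\<^sub>M s\<in>{..<T}. borel) (\<lambda>y. consistent (cw m s) (y (2 * s)) (y (2 * s + 1)))"
      using assms by (intro measurable_consistent comp) auto
    show "(\<lambda>y. if consistent (cw m s) (y (2 * s)) (y (2 * s + 1)) then 0 else 1) \<in> borel_measurable (\<Pi>\<^sub>M s\<in>{..<T}. borel)"
      by measurable
  qed
  then have "Measurable.pred (\<Pi>\<^sub>M s\<in>{..<T}. borel) (\<lambda>y. m < M \<and> mismatches cw n m y \<le> real e)" for m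
    by measurable
  then show ?thesis
    unfolding forwarding_code_def code.select_convs by (rule measurable_Least)
qed

text \<open>All inputs are bounded by 1 for every realization, which settles integrability and power
  at once.\<close>

lemma feedback_code_forwarding_code:
  assumes "0 < M" "2 * n \<le> T" and cw: "\<And>m s. cw m s \<in> symbols"
  shows "feedback_code K snr inr T (forwarding_code cw M n e)"
proof -
  let ?C = "forwarding_code cw M n e"
  interpret P: prob_space "msg_noise K T ?C" by (rule prob_space_msg_noise)
  have enc: "enc ?C k t m \<in> borel_measurable (\<Pi>\<^sub>M s\<in>{..<t}. borel)" for k t m
  proof (cases "even t")
    case False
    then have "t - 1 \<in> {..<t}" by (cases t) auto
    then have "(\<lambda>y. second_input (cw m (t div 2)) (y (t - 1))) \<in> borel_measurable (\<Pi>\<^sub>M s\<in>{..<t}. borel)"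
      by (intro measurable_compose[OF _ measurable_second_input] measurable_component_singleton)
    with False show ?thesis by (simp add: forwarding_code_def)
  qed (simp add: forwarding_code_def)
  then have menc: "measurable_encoders K T ?C" by (auto simp: measurable_encoders_def)
  have bound: "(input K snr inr ?C w z k t)\<^sup>2 \<le> 1" for w z k t
    using first_input_bounded[OF cw] second_input_bounded[OF cw]
    by (auto simp: input_def forwarding_code_def abs_square_le_1)
  have int: "integrable (msg_noise K T ?C) (\<lambda>(w, z). (input K snr inr ?C w z k t)\<^sup>2)" if "k < K" "t < T" for k t
  proof (rule P.integrable_const_bound[where B = 1])
    have "(\<lambda>z. (input K snr inr ?C w z k t)\<^sup>2) \<in> borel_measurable (noise_law K T)" for w
      unfolding measurable_cong_sets[OF sets_noise_law refl] using that
      by (intro borel_measurable_power measurable_input[OF menc, where Z = "\<lambda>z. z"] measurable_component_singleton) auto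
    then show "(\<lambda>(w, z). (input K snr inr ?C w z k t)\<^sup>2) \<in> borel_measurable (msg_noise K T ?C)"
      unfolding msg_noise_def by (rule measurable_msg_law_pair)
  qed (use bound in \<open>auto intro!: AE_I2\<close>)
  have le1: "(\<integral>(w, z). (input K snr inr ?C w z k t)\<^sup>2 \<partial>msg_noise K T ?C) \<le> 1" if "k < K" "t < T" for k t
  proof -
    have "(\<integral>(w, z). (input K snr inr ?C w z k t)\<^sup>2 \<partial>msg_noise K T ?C) \<le> (\<integral>p. 1 \<partial>msg_noise K T ?C)"
      using bound by (intro Bochner_Integration.integral_mono int[OF that]) (auto split: prod.split)
    then show ?thesis by (simp add: P.prob_space)
  qed
  have "1 / real T * (\<Sum>t<T. \<integral>(w, z). (input K snr inr ?C w z k t)\<^sup>2 \<partial>msg_noise K T ?C) \<le> 1" if "k < K" for k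
  proof -
    have "(\<Sum>t<T. \<integral>(w, z). (input K snr inr ?C w z k t)\<^sup>2 \<partial>msg_noise K T ?C) \<le> (\<Sum>t<T. 1)"
      by (intro sum_mono le1 that) auto
    then show ?thesis by (cases "T = 0") (auto simp: divide_simps)
  qed
  moreover have "0 < msgs ?C k" for k using assms(1) by (simp add: forwarding_code_def)
  ultimately show ?thesis
    unfolding feedback_code_def
    by (intro allI impI conjI enc int measurable_forwarding_decoder[OF assms(2)])
qed

text \<open>Each symbol inconsistent with the sent message contains a large noise in its two channel
  uses, so there are at most \<open>e\<close> of them. Two messages with at most \<open>e\<close>
  inconsistent symbols each would differ in at most \<open>2 * e\<close> positions.\<close>

lemma forwarding_code_decodes:
  assumes n: "2 * n \<le> T" and cw: "\<And>m s. cw m s \<in> symbols"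
    and sep: "\<And>m m'. m < M \<Longrightarrow> m' < M \<Longrightarrow> m \<noteq> m' \<Longrightarrow> 2 * e < card {s\<in>{..<n}. cw m s \<noteq> cw m' s}"
    and k: "k < K" "w k < M" and noise: "card {i\<in>{..<K} \<times> {..<T}. c < \<bar>z i\<bar>} \<le> e"
  shows "dec (forwarding_code cw M n e) k (outputs K snr inr (forwarding_code cw M n e) w z T k) = w k"
proof -
  let ?C = "forwarding_code cw M n e"
  let ?Y = "\<lambda>i. outputs K snr inr ?C w z T i"
  let ?bad = "{i\<in>{..<K} \<times> {..<T}. c < \<bar>z i\<bar>}"
  let ?inc = "\<lambda>m. {s\<in>{..<n}. \<not> consistent (cw m s) (?Y k (2 * s)) (?Y k (2 * s + 1))}"
  have in1: "input K snr inr ?C w z i (2 * s) = first_input (cw (w i) s)" for i s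
    by (simp add: input_def forwarding_code_def)
  have in2: "input K snr inr ?C w z i (2 * s + 1) = second_input (cw (w i) s) (?Y i (2 * s))" if "s < n" for i s
  proof -
    have "outputs K snr inr ?C w z (2 * s + 1) i (2 * s) = ?Y i (2 * s)"
      using that n by (intro outputs_stable[symmetric]) auto
    then show ?thesis by (simp only: input_def) (simp add: forwarding_code_def)
  qed
  have "?inc (w k) \<subseteq> (\<lambda>i. snd i div 2) ` ?bad"
  proof
    fix s assume s: "s \<in> ?inc (w k)"
    show "s \<in> (\<lambda>i. snd i div 2) ` ?bad"
    proof (rule ccontr)
      assume nb: "s \<notin> (\<lambda>i. snd i div 2) ` ?bad"
      have z: "\<bar>z (i, t)\<bar> \<le> c" if "i < K" "t div 2 = s" for i t
      proof (rule ccontr)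
        assume "\<not> \<bar>z (i, t)\<bar> \<le> c"
        moreover have "t < T" using that(2) s n by auto
        ultimately have "(i, t) \<in> ?bad" using that by auto
        with nb that(2) show False by force
      qed
      have "consistent (cw (w k) s) (?Y k (2 * s)) (?Y k (2 * s + 1))"
      proof (rule consistent_of_small_noise[where \<tau> = "\<lambda>i. cw (w i) s" and z = "\<lambda>i. z (i, 2 * s)"
              and z' = "\<lambda>i. z (i, 2 * s + 1)" and y = "\<lambda>i. ?Y i (2 * s)" and y' = "\<lambda>i. ?Y i (2 * s + 1)"])
        show "?Y i (2 * s) = channel_output K snr inr (\<lambda>j. first_input (cw (w j) s)) (\<lambda>i. z (i, 2 * s)) i" for i
          using s n by (subst outputs_eq_channel_output) (auto simp: in1)
        show "?Y i (2 * s + 1) = channel_output K snr inr (\<lambda>j. second_input (cw (w j) s) (?Y j (2 * s)))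
            (\<lambda>i. z (i, 2 * s + 1)) i" for i
          using s n in2[of s] by (subst outputs_eq_channel_output) auto
      qed (use z cw k in auto)
      with s show False by simp
    qed
  qed
  then have "card (?inc (w k)) \<le> card ((\<lambda>i. snd i div 2) ` ?bad)"
    by (intro card_mono) auto
  also have "\<dots> \<le> card ?bad" by (intro card_image_le) auto
  finally have wk: "card (?inc (w k)) \<le> e" using noise by linarith
  have unique: "m = w k" if m: "m < M" "card (?inc m) \<le> e" for m
  proof (rule ccontr)
    assume "m \<noteq> w k"
    have "{s\<in>{..<n}. cw m s \<noteq> cw (w k) s} \<subseteq> ?inc m \<union> ?inc (w k)"
      using consistent_unique[OF cw cw] by blast
    then have "card {s\<in>{..<n}. cw m s \<noteq> cw (w k) s} \<le> card (?inc m \<union> ?inc (w k))"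
      by (intro card_mono) auto
    also have "\<dots> \<le> card (?inc m) + card (?inc (w k))" by (rule card_Un_le)
    finally show False using sep[OF m(1) k(2) \<open>m \<noteq> w k\<close>] m(2) wk by linarith
  qed
  have dec_eq: "dec ?C k y = (LEAST m. m < M \<and> card {s\<in>{..<n}. \<not> consistent (cw m s) (y (2 * s)) (y (2 * s + 1))} \<le> e)" for y
    by (simp add: forwarding_code_def mismatches_eq_card)
  show ?thesis
    unfolding dec_eq
  proof (rule Least_equality)
    show "w k < M \<and> card (?inc (w k)) \<le> e" using k(2) wk by (rule conjI)
    show "w k \<le> m" if "m < M \<and> card (?inc m) \<le> e" for m
      using unique[of m] that by simp
  qed
qed

text \<open>An error requires more than \<open>e\<close>, that is at least \<open>e + 1\<close>,
  large noises.\<close>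

lemma error_prob_forwarding_code_le:
  assumes M: "0 < M" and n: "2 * n \<le> T" and cw: "\<And>m s. cw m s \<in> symbols"
    and sep: "\<And>m m'. m < M \<Longrightarrow> m' < M \<Longrightarrow> m \<noteq> m' \<Longrightarrow> 2 * e < card {s\<in>{..<n}. cw m s \<noteq> cw m' s}"
    and k: "k < K"
  shows "error_prob K snr inr T (forwarding_code cw M n e) k \<le> exp (2 * (1 / c\<^sup>2) * (real K * real T) - (real e + 1))"
proof -
  let ?C = "forwarding_code cw M n e"
  let ?P = "msg_noise K T ?C"
  interpret P: prob_space ?P by (rule prob_space_msg_noise)
  let ?E = "{(w, z) \<in> space ?P. dec ?C k (outputs K snr inr ?C w z T k) \<noteq> w k}"
  let ?b = "exp (2 * (1 / c\<^sup>2) * (real K * real T) - (real e + 1))"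
  let ?I = "{..<K} \<times> {..<T}"
  let ?F = "{z \<in> space (noise_law K T). real e + 1 \<le> real (card {i\<in>?I. c < \<bar>z i\<bar>})}"
  have F: "emeasure (noise_law K T) ?F \<le> ennreal ?b"
    using many_large_noises_le[of ?I c "1 / c\<^sup>2" "real e + 1"] std_normal_tail_le[OF c]
    by (simp add: card_cartesian_product)
  have mF: "?F \<in> sets (noise_law K T)"
    by (rule many_large_noises_measurable) simp
  have "emeasure ?P ?E = (\<integral>\<^sup>+p. indicator ?E p \<partial>?P)"
    using error_event_measurable[OF feedback_code_measurable_encoders[OF feedback_code_forwarding_code[OF M n cw]] k
        measurable_forwarding_decoder[OF n]] by simp
  \<comment> \<open>Messages outside \<open>{..<M}\<close> belong to the sample space with
    probability 0, and the decoding guarantee does not cover them.\<close>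
  also have "\<dots> \<le> (\<integral>\<^sup>+p. indicator ?F (snd p) + indicator {w. \<not> w k < M} (fst p) \<partial>?P)"
  proof (rule nn_integral_mono)
    fix p assume "p \<in> space ?P"
    then obtain w z where p: "p = (w, z)" "z \<in> space (noise_law K T)"
      by (cases p) (auto simp: msg_noise_def space_pair_measure)
    show "indicator ?E p \<le> (indicator ?F (snd p) + indicator {w. \<not> w k < M} (fst p) :: ennreal)"
    proof (cases "w k < M \<and> z \<notin> ?F")
      case True
      then have "card {i\<in>?I. c < \<bar>z i\<bar>} \<le> e" using p(2) by (simp add: not_le)
      with True have "p \<notin> ?E"
        using forwarding_code_decodes[OF n cw sep k, where w = w and z = z] p(1) by simp
      then have "indicator ?E p = (0 :: ennreal)" by (rule indicator_simps(2))
      then show ?thesis by (simp only: zero_le)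
    next
      case False
      then have "1 \<le> (indicator ?F (snd p) + indicator {w. \<not> w k < M} (fst p) :: ennreal)"
        unfolding p(1) fst_conv snd_conv by (cases "w k < M") (auto simp only: indicator_simps, auto)
      moreover have "indicator ?E p \<le> (1 :: ennreal)"
        by (simp only: indicator_def of_bool_def split: if_split) simp
      ultimately show ?thesis by (rule order_trans[rotated])
    qed
  qed
  also have "\<dots> = (\<integral>\<^sup>+p. indicator ?F (snd p) \<partial>?P) + (\<integral>\<^sup>+p. indicator {w. \<not> w k < M} (fst p) \<partial>?P)"
    using mF unfolding msg_noise_def
    by (intro nn_integral_add measurable_compose[OF measurable_snd] measurable_compose[OF measurable_fst measurable_msg_law]) auto
  also have "(\<integral>\<^sup>+p. indicator ?F (snd p) \<partial>?P) = emeasure (noise_law K T) ?F"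
    using mF by (subst nn_integral_msg_noise_snd) auto
  also have "(\<integral>\<^sup>+p. indicator {w. \<not> w k < M} (fst p) \<partial>?P) = 0"
    using M by (simp add: nn_integral_msg_noise_fst[where f = "indicator {w. \<not> w k < M}"]
        nn_integral_msg_law_resample_uniform[OF k] forwarding_code_def)
  finally have "emeasure ?P ?E \<le> emeasure (noise_law K T) ?F" by (simp only: add_0_right)
  then have "emeasure ?P ?E \<le> ennreal ?b" using F by (rule order_trans)
  then have "ennreal (measure ?P ?E) \<le> ennreal ?b" by (simp only: P.emeasure_eq_measure)
  then show ?thesis
    unfolding error_prob_def by (subst (asm) ennreal_le_iff[OF exp_ge_zero])
qed

end

section \<open>Rates of the forwarding codes\<close>

context interference_forwarding
begin

lemma card_symbols: "card symbols = (Na + 1) * ((Nb + 1) * (Nb + 1))"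
  by (simp add: symbols_def card_cartesian_product)

text \<open>The first bound, without private digits, serves \<alpha> > 1; the second serves \<alpha>
  < 1.\<close>

lemma card_symbols_ge:
  "h / (2 * common_spacing) \<le> real (card symbols)"
  "h / (2 * common_spacing) * (g / (2 * h * private_spacing))\<^sup>2 \<le> real (card symbols)"
proof -
  have a: "h / (2 * common_spacing) \<le> real (Na + 1)"
    unfolding Na_def by linarith
  have b: "g / (2 * h * private_spacing) \<le> real (Nb + 1)"
    unfolding Nb_def by linarith
  have "h / (2 * common_spacing) * 1 \<le> real (Na + 1) * real ((Nb + 1) * (Nb + 1))"
    using a pos by (intro mult_mono) auto
  then show "h / (2 * common_spacing) \<le> real (card symbols)"
    by (simp only: card_symbols of_nat_mult mult_1_right)
  have "(g / (2 * h * private_spacing))\<^sup>2 \<le> (real (Nb + 1))\<^sup>2"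
    using b pos by (intro power_mono) auto
  then have "h / (2 * common_spacing) * (g / (2 * h * private_spacing))\<^sup>2 \<le> real (Na + 1) * (real (Nb + 1))\<^sup>2"
    using a pos by (intro mult_mono) auto
  then show "h / (2 * common_spacing) * (g / (2 * h * private_spacing))\<^sup>2 \<le> real (card symbols)"
    by (simp only: card_symbols of_nat_mult power2_eq_square)
qed

lemma finite_symbols: "finite symbols" and zero_in_symbols: "(0, 0, 0) \<in> symbols"
  by (auto simp: symbols_def)

lemma symbols_nonempty: "symbols \<noteq> {}"
  using zero_in_symbols by blast

text \<open>\<open>X\<close> counts bits per symbol, that is per two channel uses: the fraction
  \<open>2 * \<delta>\<close> pays for the distance \<open>2 * e\<close> and one bit for the factor
  \<open>2 ^ n\<close> of the ball bound. The code corrects about \<open>\<delta> * T / 2\<close>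
  bad symbols, while at most \<open>\<delta> * T / 16\<close> large noises are expected.\<close>

lemma good_code_exists:
  assumes \<delta>: "0 < \<delta>" "\<delta> < 1 / 2" and c_large: "2 * (1 / c\<^sup>2) * real K \<le> \<delta> / 8"
    and X: "X = (1 - 2 * \<delta>) * log 2 (card symbols) - 1" "0 < X"
    and T: "X / (X - 2 * R) \<le> real T" and R: "2 * R < X"
  shows "\<exists>C. feedback_code K snr inr T C \<and> (\<forall>k<K. 2 powr (real T * R) \<le> real (msgs C k)) \<and>
    (\<forall>k<K. error_prob K snr inr T C k \<le> exp (\<delta> / 2 - 3 / 8 * \<delta> * real T))"
proof -
  define n where "n = T div 2"
  define e where "e = nat \<lfloor>\<delta> * real n\<rfloor>"
  have nT: "2 * n \<le> T" and Tn: "T \<le> 2 * n + 1" by (auto simp: n_def)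
  have e_le: "real e \<le> \<delta> * real n" and e_gt: "\<delta> * real n < real e + 1"
    using \<delta> by (auto simp: e_def)
  obtain cw M where M: "0 < M" and cw: "\<And>m s. cw m s \<in> symbols"
    and count: "card symbols ^ n \<le> M * (2 ^ n * card symbols ^ (2 * e))"
    and sep: "\<And>m m'. m < M \<Longrightarrow> m' < M \<Longrightarrow> m \<noteq> m' \<Longrightarrow> 2 * e < card {s\<in>{..<n}. cw m s \<noteq> cw m' s}"
    by (rule codebook[OF finite_symbols symbols_nonempty, of n "2 * e"]) (rule that)
  let ?C = "forwarding_code cw M n e"
  let ?q = "log 2 (real (card symbols))"
  have Q1: "1 \<le> real (card symbols)"
    using finite_symbols symbols_nonempty by (simp add: card_gt_0_iff Suc_le_eq)
  then have q0: "0 \<le> ?q" by simp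
  have "real (card symbols) ^ n \<le> real M * (2 ^ n * real (card symbols) ^ (2 * e))"
    using of_nat_mono[OF count, where 'a = real] by (simp only: of_nat_mult of_nat_power of_nat_numeral)
  then have "log 2 (real (card symbols) ^ n) \<le> log 2 (real M * (2 ^ n * real (card symbols) ^ (2 * e)))"
    using Q1 M by (intro log_mono) auto
  also have "\<dots> = log 2 M + (real n + 2 * real e * ?q)"
    using Q1 M by (simp add: log_mult log_nat_power)
  finally have "real n * ?q - real n - 2 * real e * ?q \<le> log 2 M"
    using Q1 by (simp add: log_nat_power)
  moreover have "real e * ?q \<le> \<delta> * real n * ?q"
    using e_le q0 by (intro mult_right_mono)
  ultimately have "real n * X \<le> log 2 M"
    by (simp add: X(1) algebra_simps)
  \<comment> \<open>For odd \<open>T\<close> one channel use is lost; the lower bound on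
    \<open>T\<close> absorbs this.\<close>
  moreover have "(real T - 1) / 2 * X \<le> real n * X"
    using Tn X(2) by (intro mult_right_mono) auto
  moreover have "X \<le> real T * (X - 2 * R)"
    using T R by (simp add: pos_divide_le_eq)
  ultimately have "real T * R \<le> log 2 M"
    by (simp add: algebra_simps)
  then have rate: "2 powr (real T * R) \<le> real M"
    using M by (subst (asm) le_log_iff) auto
  have "2 * (1 / c\<^sup>2) * (real K * real T) - (real e + 1) \<le> \<delta> / 2 - 3 / 8 * \<delta> * real T"
  proof -
    have "2 * (1 / c\<^sup>2) * real K * real T \<le> \<delta> / 8 * real T"
      using c_large by (intro mult_right_mono) auto
    then have "2 * (1 / c\<^sup>2) * (real K * real T) \<le> \<delta> * real T / 8"
      by (simp only: mult.assoc times_divide_eq_left)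
    moreover have "\<delta> * ((real T - 1) / 2) \<le> \<delta> * real n"
      using Tn \<delta> by (intro mult_left_mono) auto
    moreover have "\<delta> * ((real T - 1) / 2) = \<delta> * real T / 2 - \<delta> / 2" by (simp add: field_simps)
    moreover have "3 / 8 * \<delta> * real T = 3 / 8 * (\<delta> * real T)" by (rule mult.assoc)
    ultimately show ?thesis using e_gt by linarith
  qed
  then have mono: "exp (2 * (1 / c\<^sup>2) * (real K * real T) - (real e + 1)) \<le> exp (\<delta> / 2 - 3 / 8 * \<delta> * real T)"
    by simp
  have "error_prob K snr inr T ?C k \<le> exp (\<delta> / 2 - 3 / 8 * \<delta> * real T)" if k: "k < K" for k
  proof -
    have "error_prob K snr inr T ?C k \<le> exp (2 * (1 / c\<^sup>2) * (real K * real T) - (real e + 1))"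
      by (rule error_prob_forwarding_code_le[where cw = cw]) (fact M nT cw sep k)+
    then show ?thesis using mono by (rule order_trans)
  qed
  moreover have "feedback_code K snr inr T ?C"
    by (rule feedback_code_forwarding_code[OF M nT cw])
  moreover have "msgs ?C k = M" for k by (simp add: forwarding_code_def)
  ultimately show ?thesis using rate by (intro exI[of _ ?C]) auto
qed

lemma achievable_rate:
  assumes \<delta>: "0 < \<delta>" "\<delta> < 1 / 2" and c_large: "2 * (1 / c\<^sup>2) * real K \<le> \<delta> / 8"
    and X: "X = (1 - 2 * \<delta>) * log 2 (card symbols) - 1" "0 < X" and R: "2 * R < X"
  shows "achievable K snr inr (\<lambda>k. R)"
proof -
  let ?b = "\<lambda>T. exp (\<delta> / 2 - 3 / 8 * \<delta> * real T)"
  let ?P = "\<lambda>T C. feedback_code K snr inr T C \<and> (\<forall>k<K. 2 powr (real T * R) \<le> real (msgs C k)) \<and>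
    (X / (X - 2 * R) \<le> real T \<longrightarrow> (\<forall>k<K. error_prob K snr inr T C k \<le> ?b T))"
  have "\<exists>C. ?P T C" for T
  proof (cases "X / (X - 2 * R) \<le> real T")
    case True
    then show ?thesis using good_code_exists[OF \<delta> c_large X _ R, of T] by blast
  next
    case False
    \<comment> \<open>\<open>achievable\<close> demands a code with enough messages at every block
      length. For short blocks all users send the zero symbol, and the errors are irrelevant in the
      limit.\<close>
    define M where "M = nat \<lceil>2 powr (real T * R)\<rceil>"
    have "2 powr (real T * R) \<le> real M" unfolding M_def by linarith
    moreover from this have "0 < M" using powr_gt_zero[of 2 "real T * R"] by (cases M) auto
    moreover have "msgs (forwarding_code (\<lambda>_ _. (0, 0, 0)) M 0 0) k = M" for k
      by (simp add: forwarding_code_def)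
    ultimately show ?thesis
      using feedback_code_forwarding_code[of M 0 T "\<lambda>_ _. (0, 0, 0)" 0] zero_in_symbols False
      by (intro exI[of _ "forwarding_code (\<lambda>_ _. (0, 0, 0)) M 0 0"]) auto
  qed
  then obtain C where C: "\<And>T. ?P T (C T)" by metis
  have "(\<lambda>T. error_prob K snr inr T (C T) k) \<longlonglongrightarrow> 0" if k: "k < K" for k
  proof (rule tendsto_sandwich[OF _ _ tendsto_const])
    show "\<forall>\<^sub>F T in sequentially. 0 \<le> error_prob K snr inr T (C T) k"
      by (simp add: error_prob_def)
    have "filterlim real at_top sequentially" by (rule filterlim_real_sequentially)
    then have "\<forall>\<^sub>F T in sequentially. X / (X - 2 * R) \<le> real T"
      by (simp add: filterlim_at_top)
    then show "\<forall>\<^sub>F T in sequentially. error_prob K snr inr T (C T) k \<le> ?b T"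
      by eventually_elim (use C k in blast)
    show "?b \<longlonglongrightarrow> 0"
      using \<delta> by real_asymp
  qed
  then show ?thesis
    unfolding achievable_def using C by (intro exI[of _ C]) blast
qed

lemma R_sym_ge:
  assumes \<delta>: "0 < \<delta>" "\<delta> < 1 / 2" and c_large: "2 * (1 / c\<^sup>2) * real K \<le> \<delta> / 8"
    and X: "X = (1 - 2 * \<delta>) * log 2 (card symbols) - 1" "0 < X"
  shows "ereal (X / 2) \<le> R_sym K snr inr"
proof (rule dense_le)
  fix x assume "x < ereal (X / 2)"
  then show "x \<le> R_sym K snr inr"
  proof (cases x)
    case (real R)
    then have "achievable K snr inr (\<lambda>k. R)"
      using \<open>x < ereal (X / 2)\<close> by (intro achievable_rate[OF assms]) simp
    then show ?thesis unfolding R_sym_def real by (intro SUP_upper) simp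
  qed auto
qed

end

section \<open>Generalized degrees of freedom\<close>

lemma R_sym_le:
  assumes "2 \<le> K" "0 \<le> snr" "0 < inr"
  shows "R_sym K snr inr \<le> ereal (cost_rate K snr inr / (2 * ln 2))"
  unfolding R_sym_def
proof (rule SUP_least)
  fix R assume "R \<in> {R. achievable K snr inr (\<lambda>k. R)}"
  then have "2 * R * ln 2 \<le> cost_rate K snr inr"
    using achievable_imp_rate_le[OF assms] by simp
  then show "ereal R \<le> ereal (cost_rate K snr inr / (2 * ln 2))"
    by (simp add: field_simps)
qed

lemma d_FB_le:
  fixes \<alpha> :: real
  assumes "2 \<le> K" "0 \<le> \<alpha>" "\<alpha> \<noteq> 1"
  shows "d_FB K \<alpha> \<le> ereal (if \<alpha> < 1 then 1 - \<alpha> / 2 else \<alpha> / 2)"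
proof -
  let ?d = "if \<alpha> < 1 then 1 - \<alpha> / 2 else \<alpha> / 2"
  have lim: "((\<lambda>x. cost_rate K x (x powr \<alpha>) / ln x) \<longlongrightarrow> ?d) at_top"
  proof -
    define \<kappa> where "\<kappa> = 3 * real K / 2 * (real K + 1) + 2 * real K"
    \<comment> \<open>The first logarithm grows like \<open>max 1 \<alpha> * ln x\<close> and the
      second like \<open>max 0 (1 - \<alpha>) * ln x\<close>; the dominant terms depend on the
      case.\<close>
    consider "\<alpha> = 0" | "0 < \<alpha>" "\<alpha> < 1" | "1 < \<alpha>" using assms by linarith
    then have "((\<lambda>x. ((ln (1 + x + x powr \<alpha>) + ln (1 + x / x powr \<alpha>)) / 2 + \<kappa>) / ln x) \<longlongrightarrow> ?d) at_top"
    proof cases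
      case 1
      have "((\<lambda>x. ((ln (1 + x + 1) + ln (1 + x / 1)) / 2 + \<kappa>) / ln x) \<longlongrightarrow> 1) at_top"
        by real_asymp
      moreover have "\<forall>\<^sub>F x in at_top. ((ln (1 + x + 1) + ln (1 + x / 1)) / 2 + \<kappa>) / ln x
        = ((ln (1 + x + x powr \<alpha>) + ln (1 + x / x powr \<alpha>)) / 2 + \<kappa>) / ln x"
        using eventually_gt_at_top[of 0] by eventually_elim (simp add: 1)
      moreover have "?d = 1" using 1 by simp
      ultimately show ?thesis by (simp only:) (rule Lim_transform_eventually)
    next
      case 2
      then show ?thesis by simp real_asymp
    next
      case 3
      then show ?thesis by simp real_asymp
    qed
    then show ?thesis by (simp only: cost_rate_def \<kappa>_def add.assoc)
  qed
  have "d_FB K \<alpha> \<le> Limsup at_top (\<lambda>x. ereal (cost_rate K x (x powr \<alpha>) / ln x))"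
    unfolding d_FB_def
  proof (rule Limsup_mono)
    show "\<forall>\<^sub>F x in at_top. R_sym K x (x powr \<alpha>) / ereal (1 / 2 * log 2 x)
      \<le> ereal (cost_rate K x (x powr \<alpha>) / ln x)"
      using eventually_gt_at_top[of 1]
    proof eventually_elim
      case (elim x)
      have "R_sym K x (x powr \<alpha>) / ereal (1 / 2 * log 2 x)
        \<le> ereal (cost_rate K x (x powr \<alpha>) / (2 * ln 2)) / ereal (1 / 2 * log 2 x)"
        using elim assms by (intro ereal_divide_right_mono R_sym_le) auto
      also have "\<dots> = ereal (cost_rate K x (x powr \<alpha>) / ln x)"
        using elim by (simp add: log_def)
      finally show ?case .
    qed
  qed
  also have "\<dots> = ereal ?d"
    using lim by (intro lim_imp_Limsup) auto
  finally show ?thesis .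
qed

text \<open>For each fixed \<delta> the scheme loses only the factor \<open>1 - 2 * \<delta>\<close>
  as the signal-to-noise ratio grows; then \<delta> tends to 0.\<close>

lemma d_FB_ge:
  fixes \<alpha> :: real
  assumes K: "2 \<le> K" and \<alpha>: "0 \<le> \<alpha>" "\<alpha> \<noteq> 1"
  shows "ereal (if \<alpha> < 1 then 1 - \<alpha> / 2 else \<alpha> / 2) \<le> d_FB K \<alpha>"
proof -
  define d where "d = (if \<alpha> < 1 then 1 - \<alpha> / 2 else \<alpha> / 2)"
  have d: "0 < d" using \<alpha> by (auto simp: d_def)
  have step: "ereal ((1 - 2 * \<delta>) * d) \<le> d_FB K \<alpha>" if \<delta>: "0 < \<delta>" "\<delta> < 1 / 2" for \<delta>
  proof -
    \<comment> \<open>Chosen so that the condition \<open>c_large\<close> holds with equality. It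
      does not depend on \<open>x\<close>, so the spacings below are constants.\<close>
    define c where "c = sqrt (16 * real K / \<delta>)"
    have c: "0 < c" using \<delta> K by (simp add: c_def)
    have c_large: "2 * (1 / c\<^sup>2) * real K \<le> \<delta> / 8"
      using \<delta> K by (simp add: c_def)
    define s where "s = interference_forwarding.common_spacing K c"
    define p where "p = interference_forwarding.private_spacing K c"
    define \<kappa> where "\<kappa> = max (log 2 (2 * s)) (log 2 (8 * s * p\<^sup>2))"
    define X where "X x = (1 - 2 * \<delta>) * (d * log 2 x - \<kappa>) - 1" for x
    \<comment> \<open>The ratio of the larger to the smaller gain is a positive power of
      \<open>x\<close>, hence eventually at least 2.\<close>
    have "\<forall>\<^sub>F x in at_top. max (sqrt x) (sqrt (x powr \<alpha>)) \<le> 2 * \<bar>sqrt x - sqrt (x powr \<alpha>)\<bar>"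
    proof (cases "\<alpha> < 1")
      case True
      have gap: "max a b \<le> 2 * \<bar>a - b\<bar>" if "2 * b \<le> a" "0 \<le> b" for a b :: real
        using that by (auto simp: max_def abs_if)
      have "\<forall>\<^sub>F x :: real in at_top. 2 \<le> x powr ((1 - \<alpha>) / 2)"
        using True by real_asymp
      then show ?thesis
        using eventually_gt_at_top[of 0]
      proof eventually_elim
        case (elim x)
        have "sqrt x = x powr ((1 - \<alpha>) / 2) * sqrt (x powr \<alpha>)"
          using elim by (simp add: powr_half_sqrt[symmetric] powr_powr field_simps flip: powr_add)
        moreover have "2 * sqrt (x powr \<alpha>) \<le> x powr ((1 - \<alpha>) / 2) * sqrt (x powr \<alpha>)"
          using elim by (intro mult_right_mono) auto
        ultimately show ?case by (intro gap) auto
      qed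
    next
      case False
      have gap: "max a b \<le> 2 * \<bar>a - b\<bar>" if "2 * a \<le> b" "0 \<le> a" for a b :: real
        using that by (auto simp: max_def abs_if)
      have "0 < (\<alpha> - 1) / 2" using False \<alpha> by simp
      then have "\<forall>\<^sub>F x :: real in at_top. 2 \<le> x powr ((\<alpha> - 1) / 2)"
        by real_asymp
      then show ?thesis
        using eventually_gt_at_top[of 0]
      proof eventually_elim
        case (elim x)
        have "sqrt (x powr \<alpha>) = x powr ((\<alpha> - 1) / 2) * sqrt x"
          using elim by (simp add: powr_half_sqrt[symmetric] powr_powr field_simps flip: powr_add)
        moreover have "2 * sqrt x \<le> x powr ((\<alpha> - 1) / 2) * sqrt x"
          using elim by (intro mult_right_mono) auto
        ultimately show ?case using elim by (intro gap) auto
      qed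
    qed
    moreover have "\<forall>\<^sub>F x in at_top. 0 < X x"
      unfolding X_def using d \<delta> by real_asymp
    ultimately have ev: "\<forall>\<^sub>F x in at_top. ereal (X x / log 2 x) \<le> R_sym K x (x powr \<alpha>) / ereal (1 / 2 * log 2 x)"
      using eventually_gt_at_top[of 1]
    proof eventually_elim
      case (elim x)
      interpret interference_forwarding K x "x powr \<alpha>" c
        using elim K c \<alpha> by unfold_locales (auto intro: ge_one_powr_ge_zero)
      have sp: "common_spacing = s" "private_spacing = p" by (simp_all add: s_def p_def)
      have sp0: "0 < s" "0 < p" using pos sp by auto
      have h: "sqrt (x powr \<alpha>) = x powr (\<alpha> / 2)" and g: "sqrt x = x powr (1 / 2)"
        using elim by (simp_all add: powr_half_sqrt[symmetric] powr_powr)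
      have "d * log 2 x - \<kappa> \<le> log 2 (card symbols)"
      proof (cases "\<alpha> < 1")
        case True
        have "d * log 2 x - \<kappa> \<le> d * log 2 x - log 2 (8 * s * p\<^sup>2)" by (simp add: \<kappa>_def)
        also have "\<dots> = log 2 (x powr d / (8 * s * p\<^sup>2))"
          using elim sp0 by (simp add: log_divide log_powr)
        \<comment> \<open>With \<open>H\<close> for the cross gain, the product is
          \<open>x / H\<close> up to constants, which is
          \<open>x powr (1 - \<alpha> / 2)\<close>.\<close>
        also have "x powr d / (8 * s * p\<^sup>2) = sqrt (x powr \<alpha>) / (2 * s) * (sqrt x / (2 * sqrt (x powr \<alpha>) * p))\<^sup>2"
        proof -
          have xd: "x powr d = x / x powr (\<alpha> / 2)"
            using elim True by (simp add: d_def powr_diff)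
          have sq: "(sqrt x / (2 * H * p))\<^sup>2 = x / (4 * H\<^sup>2 * p\<^sup>2)" for H
            using elim by (simp add: power_divide power_mult_distrib)
          have "x / H / (8 * s * p\<^sup>2) = H / (2 * s) * (x / (4 * H\<^sup>2 * p\<^sup>2))" if "0 < H" for H
            using sp0 that by (simp add: power2_eq_square)
          then show ?thesis
            unfolding xd sq h using elim by simp
        qed
        also have "log 2 \<dots> \<le> log 2 (card symbols)"
          using card_symbols_ge(2) elim sp0 by (intro log_mono) (auto simp: sp)
        finally show ?thesis .
      next
        case False
        have "d * log 2 x - \<kappa> \<le> d * log 2 x - log 2 (2 * s)" by (simp add: \<kappa>_def)
        also have "\<dots> = log 2 (sqrt (x powr \<alpha>) / (2 * s))"
          using elim sp0 False by (simp add: log_divide log_powr d_def h)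
        also have "\<dots> \<le> log 2 (card symbols)"
          using card_symbols_ge(1) elim sp0 by (intro log_mono) (auto simp: sp)
        finally show ?thesis .
      qed
      then have "X x \<le> (1 - 2 * \<delta>) * log 2 (card symbols) - 1"
        unfolding X_def using \<delta> by (intro diff_right_mono mult_left_mono) auto
      then have "ereal (X x / 2) \<le> ereal (((1 - 2 * \<delta>) * log 2 (card symbols) - 1) / 2)"
        by simp
      also have "\<dots> \<le> R_sym K x (x powr \<alpha>)"
        using \<open>X x \<le> _\<close> elim by (intro R_sym_ge[OF \<delta> c_large refl]) linarith
      finally have "ereal (X x / 2) / ereal (1 / 2 * log 2 x) \<le> R_sym K x (x powr \<alpha>) / ereal (1 / 2 * log 2 x)"
        using elim by (intro ereal_divide_right_mono) auto
      moreover have "ereal (X x / 2) / ereal (1 / 2 * log 2 x) = ereal (X x / log 2 x)"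
        using elim by (simp add: less_imp_neq[symmetric])
      ultimately show ?case by (simp only:)
    qed
    have "((\<lambda>x. X x / log 2 x) \<longlongrightarrow> (1 - 2 * \<delta>) * d) at_top"
      unfolding X_def using d \<delta> by real_asymp
    then have "ereal ((1 - 2 * \<delta>) * d) = Limsup at_top (\<lambda>x. ereal (X x / log 2 x))"
      by (intro lim_imp_Limsup[symmetric]) auto
    also have "\<dots> \<le> d_FB K \<alpha>"
      unfolding d_FB_def by (rule Limsup_mono[OF ev])
    finally show ?thesis .
  qed
  have "((\<lambda>\<delta>. ereal ((1 - 2 * \<delta>) * d)) \<longlongrightarrow> ereal ((1 - 2 * 0) * d)) (at_right 0)"
    by (intro tendsto_intros)
  moreover have "\<forall>\<^sub>F \<delta> in at_right 0. ereal ((1 - 2 * \<delta>) * d) \<le> d_FB K \<alpha>"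
    by (rule eventually_mono[OF eventually_at_right_real[of 0 "1 / 2"]]) (use step in auto)
  ultimately have "ereal ((1 - 2 * 0) * d) \<le> d_FB K \<alpha>"
    by (intro tendsto_upperbound) auto
  then show ?thesis by (simp add: d_def)
qed

theorem theorem1:
  fixes K :: nat and \<alpha> :: real
  assumes "K \<ge> 2" and "\<alpha> \<ge> 0" and "\<alpha> \<noteq> 1"
  shows "d_FB K \<alpha> = ereal (if \<alpha> < 1 then 1 - \<alpha> / 2 else \<alpha> / 2)"
  by (rule antisym[OF d_FB_le d_FB_ge]) (use assms in auto)

end
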